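(* Let $\mathcal H_1,\mathcal H_2$ be real separable Hilbert spaces, $\mathcal H=\mathcal H_1\otimes\mathcal H_2$, and let $R\in\mathbb N$. Let $X_1,\ldots,X_N\sim X$ be i.i.d. random elements of $\mathcal H$ with $\mathbb E(\|X\|^4)<\infty$. Assume that the covariance $C$ of $X$ has separable expansion $C=\sum_{i=1}^\infty \sigma_i\, A_i\,\tilde\otimes\, B_i$ with $\sigma_1>\cdots>\sigma_R>\sigma_{R+1}\ge\cdots\ge 0$. Define $\alpha_i=\min\{\sigma_{i-1}^2-\sigma_i^2,\ \sigma_i^2-\sigma_{i+1}^2\}$ for $i=1,\ldots,R$ (with $\sigma_0=+\infty$, i.e. $\alpha_1=\sigma_1^2-\sigma_2^2$), and let $a_R=\|C\|_2\sum_{i=1}^R(\sigma_i/\alpha_i)$, where $\|\cdot\|_2$ denotes the Hilbert–Schmidt norm. Let $\widehat C_{R,N}$ be the best $R$-separable approximation of the empirical covariance $\widehat C_N$ of $X_1,\ldots,X_N$. Then, as $N\to\infty$, $$\|\widehat C_{R,N}-C\|_2\ \le\ \Big(\sum_{i=R+1}^\infty\sigma_i^2\Big)^{1/2}+\mathcal O_{\mathbb P}\Big(\frac{a_R}{\sqrt N}\Big).$$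
   Context: For a Hilbert space $\mathcal K$, $\mathcal S_2(\mathcal K)$ is the Hilbert space of Hilbert–Schmidt operators on $\mathcal K$, with norm $\|\cdot\|_2$. For $A\in\mathcal S_2(\mathcal H_1)$, $B\in\mathcal S_2(\mathcal H_2)$, $A\,\tilde\otimes\,B$ is the unique operator in $\mathcal S_2(\mathcal H_1\otimes\mathcal H_2)$ with $(A\,\tilde\otimes\,B)(x\otimes y)=Ax\otimes By$ for all $x\in\mathcal H_1,y\in\mathcal H_2$; this identifies $\mathcal S_2(\mathcal H_1)\otimes\mathcal S_2(\mathcal H_2)$ isometrically with $\mathcal S_2(\mathcal H_1\otimes\mathcal H_2)$. A separable expansion of $C\in\mathcal S_2(\mathcal H_1\otimes\mathcal H_2)$ is a representation $C=\sum_{j\ge1}\sigma_j A_j\,\tilde\otimes\,B_j$ with $\sigma_1\ge\sigma_2\ge\cdots\ge0$ (the scores) and $\{A_j\}$, $\{B_j\}$ orthonormal bases of $\mathcal S_2(\mathcal H_1)$, $\mathcal S_2(\mathcal H_2)$; it is the singular value decomposition of $C$ viewed as a Hilbert–Schmidt operator from $\mathcal H_2\otimes\mathcal H_2$ to $\mathcal H_1\otimes\mathcal H_1$. We write $\mathrm{DoS}(G)\le R$ if at most $R$ scores of $G$ are nonzero, equivalently $G$ is a sum of $R$ operators of the form $A\,\tilde\otimes\,B$. The best $R$-separable approximation of $F\in\mathcal S_2(\mathcal H)$ is $\arg\min_G\|F-G\|_2^2$ subject to $\mathrm{DoS}(G)\le R$; it is the truncation of the separable expansion of $F$ to its first $R$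 terms. The covariance of $X$ is $C=\mathbb E[(X-m)\otimes(X-m)]$, $m=\mathbb E X$, regarded as an element of $\mathcal S_2(\mathcal H)$. The empirical covariance is $\widehat C_N=N^{-1}\sum_{n=1}^N(X_n-\bar X)\otimes(X_n-\bar X)$ with $\bar X=N^{-1}\sum_n X_n$. *)

theory Defs
  imports "HOL-Probability.Probability"
begin

definition orthonormal_family :: "'i set \<Rightarrow> ('i \<Rightarrow> 'a::real_inner) \<Rightarrow> bool" where
  "orthonormal_family J f \<longleftrightarrow> (\<forall>i\<in>J. \<forall>j\<in>J. inner (f i) (f j) = (if i = j then 1 else 0))"

definition orthonormal_basis :: "'a::real_inner set \<Rightarrow> bool" where
  "orthonormal_basis E \<longleftrightarrow> orthonormal_family E (\<lambda>e. e) \<and> closure (span E) = UNIV"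

lemma orthonormal_extend:
  fixes x :: "'a::real_inner"
  assumes "finite E" "orthonormal_family E (\<lambda>e. e)"
  shows "\<exists>E'. finite E' \<and> orthonormal_family E' (\<lambda>e. e) \<and> E \<subseteq> E' \<and> x \<in> span E'"
proof -
  define p where "p = (\<Sum>e\<in>E. inner x e *\<^sub>R e)"
  define y where "y = x - p"
  have p: "p \<in> span E"
    unfolding p_def by (intro span_sum span_scale span_base)
  have orth: "inner y e = 0" "inner e y = 0" if "e \<in> E" for e
  proof -
    have "inner p e = (\<Sum>f\<in>E. if f = e then inner x f else 0)"
      unfolding p_def inner_sum_left
      by (rule sum.cong) (use assms(2) that in \<open>simp_all add: orthonormal_family_def\<close>)
    then show "inner y e = 0"
      using assms(1) that by (simp add: y_def inner_diff_left)
    then show "inner e y = 0"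
      by (simp add: inner_commute)
  qed
  show ?thesis
  proof (cases "y = 0")
    case True
    then have "x \<in> span E"
      using p by (simp add: y_def)
    then show ?thesis
      using assms by blast
  next
    case False
    define u where "u = y /\<^sub>R norm y"
    have uu: "inner u u = 1"
      using False by (simp add: u_def dot_square_norm power2_eq_square)
    have ue: "inner u e = 0" "inner e u = 0" if "e \<in> E" for e
      using orth[OF that] by (simp_all add: u_def)
    have "u \<notin> E"
      using ue(1)[of u] uu by auto
    then have "orthonormal_family (insert u E) (\<lambda>e. e)"
      using assms(2) ue uu by (auto simp: orthonormal_family_def)
    moreover have "x \<in> span (insert u E)"
    proof -
      have "x = p + norm y *\<^sub>R u"
        using False by (simp add: u_def y_def)
      moreover have "p \<in> span (insert u E)"
        using p span_mono[of E "insert u E"] by blast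
      ultimately show ?thesis
        using span_add[of p _ "norm y *\<^sub>R u"] span_scale[OF span_base[of u "insert u E"]] by simp
    qed
    ultimately show ?thesis
      using assms(1) by (intro exI[of _ "insert u E"]) auto
  qed
qed

lemma orthonormal_basis_exists:
  "\<exists>E :: 'a::{real_inner, second_countable_topology} set. orthonormal_basis E"
proof -
  obtain D :: "'a set" where D: "countable D" "\<And>X. open X \<Longrightarrow> X \<noteq> {} \<Longrightarrow> \<exists>d\<in>D. d \<in> X"
    using countable_dense_setE by metis
  have "D \<noteq> {}"
    using D(2)[of UNIV] by auto
  define d where "d = from_nat_into D"
  have d: "range d = D"
    unfolding d_def using D(1) \<open>D \<noteq> {}\<close> by (simp add: range_from_nat_into)
  have "\<exists>E. \<forall>n. (finite (E n) \<and> orthonormal_family (E n) (\<lambda>e::'a. e)) \<and>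
           (E n \<subseteq> E (Suc n) \<and> d n \<in> span (E (Suc n)))"
  proof (rule dependent_nat_choice)
    show "\<exists>x. finite x \<and> orthonormal_family x (\<lambda>e::'a. e)"
      by (rule exI[of _ "{}"]) (simp add: orthonormal_family_def)
  next
    fix E n
    assume "finite E \<and> orthonormal_family E (\<lambda>e::'a. e)"
    then show "\<exists>E'. (finite E' \<and> orthonormal_family E' (\<lambda>e. e)) \<and> E \<subseteq> E' \<and> d n \<in> span E'"
      using orthonormal_extend[of E "d n"] by blast
  qed
  then obtain E where E: "\<And>n. orthonormal_family (E n) (\<lambda>e::'a. e)"
    "\<And>n. E n \<subseteq> E (Suc n)" "\<And>n. d n \<in> span (E (Suc n))"
    by blast
  have mono: "E m \<subseteq> E n" if "m \<le> n" for m n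
    using that E(2) by (rule lift_Suc_mono_le[rotated])
  have "orthonormal_family (\<Union>n. E n) (\<lambda>e. e)"
    unfolding orthonormal_family_def
  proof (intro ballI)
    fix a b assume "a \<in> (\<Union>n. E n)" "b \<in> (\<Union>n. E n)"
    then obtain m n where "a \<in> E m" "b \<in> E n"
      by blast
    then have "a \<in> E (max m n)" "b \<in> E (max m n)"
      using mono[of m "max m n"] mono[of n "max m n"] by auto
    then show "inner a b = (if a = b then 1 else 0)"
      using E(1)[of "max m n"] by (auto simp: orthonormal_family_def)
  qed
  moreover have "closure (span (\<Union>n. E n)) = UNIV"
  proof -
    have "D \<subseteq> span (\<Union>n. E n)"
    proof
      fix x assume "x \<in> D"
      then obtain n where "x = d n"
        using d by blast
      then show "x \<in> span (\<Union>n. E n)"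
        using E(3)[of n] span_mono[of "E (Suc n)" "\<Union>n. E n"] by blast
    qed
    moreover have "closure D = UNIV"
      using D(2) by (auto simp: closure_iff_nhds_not_empty) blast
    ultimately show ?thesis
      using closure_mono by blast
  qed
  ultimately show ?thesis
    unfolding orthonormal_basis_def by blast
qed

lemma orthonormal_basis_countable:
  fixes E :: "'a::{real_inner, second_countable_topology} set"
  assumes "orthonormal_family E (\<lambda>e. e)"
  shows "countable E"
proof -
  have far: "dist a b \<ge> 1" if "a \<in> E" "b \<in> E" "a \<noteq> b" for a b
  proof -
    have "(dist a b)\<^sup>2 = 2"
      using assms that
      by (simp add: orthonormal_family_def dist_norm power2_norm_eq_inner inner_diff_left inner_diff_right)
    then show ?thesis
      by (intro power2_le_imp_le[of 1]) auto
  qed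
  have "inj_on (\<lambda>e. ball e (1/2)) E"
  proof (rule inj_onI, rule ccontr)
    fix a b assume *: "a \<in> E" "b \<in> E" "ball a (1/2) = ball b (1/2)" "a \<noteq> b"
    then have "b \<in> ball a (1/2)"
      by simp
    then show False
      using far[OF *(1,2,4)] by simp
  qed
  moreover have "countable ((\<lambda>e. ball e (1/2)) ` E)"
  proof (rule countable_disjoint_open_subsets)
    show "disjoint ((\<lambda>e. ball e (1/2)) ` E)"
    proof (rule disjointI, elim imageE, simp)
      fix a b assume *: "a \<in> E" "b \<in> E" "ball a (1/2) \<noteq> ball b (1/2)"
      then have "dist a b \<ge> 1"
        using far by blast
      then show "ball a (1/2) \<inter> ball b (1/2) = {}"
        by (intro disjoint_ballI) simp
    qed
  qed auto
  ultimately show ?thesis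
    using countable_image_inj_on by blast
qed

lemma orthonormal_finite_approx:
  fixes x :: "'a::real_inner"
  assumes "finite G" "orthonormal_family G (\<lambda>e. e)" "y \<in> span G"
  shows "norm (x - (\<Sum>e\<in>G. inner x e *\<^sub>R e)) \<le> norm (x - y)"
proof -
  define p where "p = (\<Sum>e\<in>G. inner x e *\<^sub>R e)"
  have orth: "inner (x - p) e = 0" if "e \<in> G" for e
  proof -
    have "inner p e = (\<Sum>f\<in>G. if f = e then inner x f else 0)"
      unfolding p_def inner_sum_left
      by (rule sum.cong) (use assms(2) that in \<open>auto simp: orthonormal_family_def\<close>)
    then show ?thesis
      using assms(1) that by (simp add: inner_diff_left)
  qed
  have "p - y \<in> span G"
    unfolding p_def by (intro span_diff span_sum span_scale span_base assms) auto
  then have "orthogonal (x - p) (p - y)"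
    by (rule orthogonal_to_span) (use orth in \<open>simp add: orthogonal_def\<close>)
  then have "(norm (x - y))\<^sup>2 = (norm (x - p))\<^sup>2 + (norm (p - y))\<^sup>2"
    using norm_add_Pythagorean[of "x - p" "p - y"] by simp
  then show ?thesis
    unfolding p_def[symmetric] by (intro power2_le_imp_le[OF _ norm_ge_zero]) simp
qed

lemma orthonormal_basis_expansion:
  fixes x :: "'a::real_inner"
  assumes "orthonormal_basis E"
  shows "((\<lambda>e. inner x e *\<^sub>R e) has_sum x) E"
  unfolding has_sum_def tendsto_iff eventually_finite_subsets_at_top
proof (intro allI impI)
  fix \<epsilon> :: real assume "\<epsilon> > 0"
  have on: "orthonormal_family E (\<lambda>e. e)" and "x \<in> closure (span E)"
    using assms by (auto simp: orthonormal_basis_def)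
  then obtain y where y: "y \<in> span E" "dist y x < \<epsilon>"
    using \<open>\<epsilon> > 0\<close> closure_approachable by blast
  then obtain F r where F: "finite F" "F \<subseteq> E" "y = (\<Sum>a\<in>F. r a *\<^sub>R a)"
    unfolding span_explicit by blast
  have "y \<in> span F"
    unfolding F(3) by (intro span_sum span_scale span_base)
  show "\<exists>F. finite F \<and> F \<subseteq> E \<and>
          (\<forall>G. finite G \<and> F \<subseteq> G \<and> G \<subseteq> E \<longrightarrow> dist (\<Sum>e\<in>G. inner x e *\<^sub>R e) x < \<epsilon>)"
  proof (intro exI conjI allI impI)
    fix G assume G: "finite G \<and> F \<subseteq> G \<and> G \<subseteq> E"
    then have "orthonormal_family G (\<lambda>e. e)"
      using on by (simp add: orthonormal_family_def subset_iff)
    moreover have "y \<in> span G"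
      using G \<open>y \<in> span F\<close> span_mono[of F G] by blast
    ultimately have "norm (x - (\<Sum>e\<in>G. inner x e *\<^sub>R e)) \<le> norm (x - y)"
      using G by (intro orthonormal_finite_approx) auto
    then show "dist (\<Sum>e\<in>G. inner x e *\<^sub>R e) x < \<epsilon>"
      using y(2) by (simp add: dist_norm norm_minus_commute)
  qed (use F in auto)
qed

definition some_onb :: "'a::{real_inner, second_countable_topology} set" where
  "some_onb = (SOME E. orthonormal_basis E)"

lemma some_onb: "orthonormal_basis some_onb"
  unfolding some_onb_def using orthonormal_basis_exists by (rule someI_ex)

lemma some_onb_inner:
  "e \<in> some_onb \<Longrightarrow> f \<in> some_onb \<Longrightarrow> inner e f = (if e = f then 1 else 0)"
  using some_onb by (auto simp: orthonormal_basis_def orthonormal_family_def)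

lemma countable_some_onb: "countable some_onb"
  using some_onb orthonormal_basis_countable by (auto simp: orthonormal_basis_def)

lemma parseval_inner:
  "((\<lambda>e. inner x e * inner y e) has_sum inner x y) some_onb"
  using has_sum_bounded_linear[OF bounded_linear_inner_right[of y] orthonormal_basis_expansion[OF some_onb, of x]]
  by (simp add: o_def inner_commute)

lemma blinfun_expansion:
  "((\<lambda>e. inner x e *\<^sub>R blinfun_apply A e) has_sum blinfun_apply A x) some_onb"
  using has_sum_bounded_linear[OF blinfun.bounded_linear_right[of A] orthonormal_basis_expansion[OF some_onb, of x]]
  by (simp add: o_def blinfun.scaleR_right)

text \<open>
  Hilbert--Schmidt operators between separable Hilbert spaces; the space \<open>S\<^sub>2(K)\<close> is
  \<open>('k, 'k) hs\<close>. The Hilbert--Schmidt inner product is computed in one arbitrarily chosen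
  orthonormal basis, since on Hilbert spaces neither it nor the Hilbert--Schmidt property
  depends on that choice.
\<close>

typedef (overloaded) ('a, 'b) hs =
  "{A :: 'a::{real_inner, second_countable_topology} \<Rightarrow>\<^sub>L 'b::real_inner.
      (\<lambda>e. (norm (blinfun_apply A e))\<^sup>2) summable_on some_onb}"
  morphisms blinfun_of_hs Abs_hs
  by (rule exI[of _ 0]) simp

definition hs_apply :: "('a::{real_inner, second_countable_topology}, 'b::real_inner) hs \<Rightarrow> 'a \<Rightarrow> 'b" where
  "hs_apply A x = blinfun_apply (blinfun_of_hs A) x"

abbreviation hs_op :: "('a::{real_inner, second_countable_topology} \<Rightarrow>\<^sub>L 'b::real_inner) \<Rightarrow> bool" where
  "hs_op A \<equiv> (\<lambda>e. (norm (blinfun_apply A e))\<^sup>2) summable_on some_onb"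

lemma hs_op_hs: "hs_op (blinfun_of_hs A)"
  using blinfun_of_hs[of A] by simp

lemma hs_op_inner:
  assumes "hs_op A" "hs_op B"
  shows "(\<lambda>e. inner (blinfun_apply A e) (blinfun_apply B e)) summable_on some_onb"
proof -
  have "(\<lambda>e. norm (inner (blinfun_apply A e) (blinfun_apply B e))) summable_on some_onb"
  proof (rule Infinite_Sum.abs_summable_on_comparison_test')
    show "(\<lambda>e. (norm (blinfun_apply A e))\<^sup>2 + (norm (blinfun_apply B e))\<^sup>2) summable_on some_onb"
      using assms by (rule summable_on_add)
  next
    fix e
    have "\<bar>inner (A e) (B e)\<bar> \<le> norm (A e) * norm (B e)"
      by (rule Cauchy_Schwarz_ineq2)
    also have "\<dots> \<le> (norm (A e))\<^sup>2 + (norm (B e))\<^sup>2"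
      using sum_squares_bound[of "norm (A e)" "norm (B e)"]
        zero_le_power2[of "norm (A e)"] zero_le_power2[of "norm (B e)"]
      unfolding mult.assoc by linarith
    finally show "norm (inner (A e) (B e)) \<le> (norm (A e))\<^sup>2 + (norm (B e))\<^sup>2"
      by simp
  qed
  then show ?thesis
    by (rule Infinite_Sum.abs_summable_summable)
qed

lemma hs_op_zero: "hs_op 0"
  by simp

lemma hs_op_scaleR: "hs_op A \<Longrightarrow> hs_op (r *\<^sub>R A)"
  by (simp add: blinfun.scaleR_left power_mult_distrib summable_on_cmult_right)

lemma hs_op_add:
  assumes "hs_op A" "hs_op B" shows "hs_op (A + B)"
proof -
  have "(\<lambda>e. (norm (A e))\<^sup>2 + 2 * inner (A e) (B e) + (norm (B e))\<^sup>2) summable_on some_onb"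
    by (intro summable_on_add summable_on_cmult_right hs_op_inner assms)
  then show ?thesis
    by (rule summable_on_cong[THEN iffD1, rotated])
      (simp add: power2_norm_eq_inner blinfun.add_left inner_add_left inner_add_right inner_commute)
qed

lemma hs_op_uminus: "hs_op A \<Longrightarrow> hs_op (- A)"
  by (simp add: blinfun.minus_left)

lemma hs_op_diff: "hs_op A \<Longrightarrow> hs_op B \<Longrightarrow> hs_op (A - B)"
  using hs_op_add[of A "- B"] hs_op_uminus[of B] by simp

instantiation hs :: ("{real_inner, second_countable_topology}", real_inner) real_inner
begin

definition "0 = Abs_hs 0"
definition "A + B = Abs_hs (blinfun_of_hs A + blinfun_of_hs B)"
definition "A - B = Abs_hs (blinfun_of_hs A - blinfun_of_hs B)"
definition "- A = Abs_hs (- blinfun_of_hs A)"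
definition "r *\<^sub>R A = Abs_hs (r *\<^sub>R blinfun_of_hs A)"
definition inner_hs :: "('a, 'b) hs \<Rightarrow> ('a, 'b) hs \<Rightarrow> real" where
  "inner_hs A B = (\<Sum>\<^sub>\<infinity>e\<in>some_onb. inner (hs_apply A e) (hs_apply B e))"
definition norm_hs :: "('a, 'b) hs \<Rightarrow> real" where
  "norm_hs A = sqrt (inner A A)"
definition dist_hs :: "('a, 'b) hs \<Rightarrow> ('a, 'b) hs \<Rightarrow> real" where
  "dist_hs A B = norm (A - B)"
definition sgn_hs :: "('a, 'b) hs \<Rightarrow> ('a, 'b) hs" where
  "sgn_hs A = scaleR (inverse (norm A)) A"
definition uniformity_hs :: "(('a, 'b) hs \<times> ('a, 'b) hs) filter" where
  "uniformity_hs = (INF e\<in>{0<..}. principal {(A, B). dist A B < e})"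
definition open_hs :: "('a, 'b) hs set \<Rightarrow> bool" where
  "open_hs U \<longleftrightarrow> (\<forall>A\<in>U. eventually (\<lambda>(A', B). A' = A \<longrightarrow> B \<in> U) uniformity)"

lemma blinfun_of_hs_simps:
  "blinfun_of_hs 0 = 0"
  "blinfun_of_hs (A + B) = blinfun_of_hs A + blinfun_of_hs B"
  "blinfun_of_hs (A - B) = blinfun_of_hs A - blinfun_of_hs B"
  "blinfun_of_hs (- A) = - blinfun_of_hs A"
  "blinfun_of_hs (r *\<^sub>R A) = r *\<^sub>R blinfun_of_hs A"
proof -
  have inv: "blinfun_of_hs (Abs_hs T) = T" if "hs_op T" for T :: "'a \<Rightarrow>\<^sub>L 'b"
    using that by (intro Abs_hs_inverse) blast
  show "blinfun_of_hs 0 = 0"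
    unfolding zero_hs_def by (rule inv[OF hs_op_zero])
  show "blinfun_of_hs (A + B) = blinfun_of_hs A + blinfun_of_hs B"
    unfolding plus_hs_def by (rule inv[OF hs_op_add[OF hs_op_hs hs_op_hs]])
  show "blinfun_of_hs (A - B) = blinfun_of_hs A - blinfun_of_hs B"
    unfolding minus_hs_def by (rule inv[OF hs_op_diff[OF hs_op_hs hs_op_hs]])
  show "blinfun_of_hs (- A) = - blinfun_of_hs A"
    unfolding uminus_hs_def by (rule inv[OF hs_op_uminus[OF hs_op_hs]])
  show "blinfun_of_hs (r *\<^sub>R A) = r *\<^sub>R blinfun_of_hs A"
    unfolding scaleR_hs_def by (rule inv[OF hs_op_scaleR[OF hs_op_hs]])
qed

instance
proof
  fix A B D :: "('a, 'b) hs" and r s :: real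
  note eq = blinfun_of_hs_inject[symmetric] blinfun_of_hs_simps
  note sm = hs_op_inner[OF hs_op_hs hs_op_hs]
  show "A + B + D = A + (B + D)" "A + B = B + A" "0 + A = A" "- A + A = 0" "A - B = A + - B"
    "r *\<^sub>R (A + B) = r *\<^sub>R A + r *\<^sub>R B" "(r + s) *\<^sub>R A = r *\<^sub>R A + s *\<^sub>R A"
    "r *\<^sub>R s *\<^sub>R A = (r * s) *\<^sub>R A" "1 *\<^sub>R A = A"
    by (simp_all add: eq scaleR_add_right scaleR_add_left)
  show "dist A B = norm (A - B)" "sgn A = scaleR (inverse (norm A)) A" "norm A = sqrt (inner A A)"
    by (rule dist_hs_def sgn_hs_def norm_hs_def)+
  show "uniformity = (INF e\<in>{0<..}. principal {(A :: ('a, 'b) hs, B). dist A B < e})"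
    by (rule uniformity_hs_def)
  show "open U \<longleftrightarrow> (\<forall>A\<in>U. \<forall>\<^sub>F (A', B) in uniformity. A' = A \<longrightarrow> B \<in> U)"
    for U :: "('a, 'b) hs set"
    by (rule open_hs_def)
  show "inner A B = inner B A"
    by (simp add: inner_hs_def inner_commute)
  show "inner (A + B) D = inner A D + inner B D"
    unfolding inner_hs_def hs_apply_def blinfun_of_hs_simps blinfun.add_left inner_add_left
    by (rule infsum_add) (rule sm)+
  show "inner (r *\<^sub>R A) B = r * inner A B"
    unfolding inner_hs_def hs_apply_def blinfun_of_hs_simps blinfun.scaleR_left inner_scaleR_left
    by (rule infsum_cmult_right) (rule sm)
  show "0 \<le> inner A A"
    unfolding inner_hs_def by (rule infsum_nonneg) simp
  show "inner A A = 0 \<longleftrightarrow> A = 0"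
  proof
    assume "A = 0"
    then show "inner A A = 0"
      by (simp add: inner_hs_def hs_apply_def blinfun_of_hs_simps)
  next
    assume *: "inner A A = 0"
    have zero: "blinfun_apply (blinfun_of_hs A) e = 0" if "e \<in> some_onb" for e
    proof -
      have "inner (hs_apply A e) (hs_apply A e) = 0"
        by (rule nonneg_infsum_le_0D[where A = some_onb and f = "\<lambda>e. inner (hs_apply A e) (hs_apply A e)"])
          (use * that sm[of A A] in \<open>simp_all add: inner_hs_def hs_apply_def\<close>)
      then show ?thesis
        by (simp add: hs_apply_def)
    qed
    have "blinfun_apply (blinfun_of_hs A) x = 0" for x
    proof -
      have "((\<lambda>e. inner x e *\<^sub>R blinfun_apply (blinfun_of_hs A) e) has_sum 0) some_onb"
        by (rule has_sum_0) (simp add: zero)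
      then show ?thesis
        using blinfun_expansion has_sum_unique by blast
    qed
    then show "A = 0"
      unfolding eq by (intro blinfun_eqI) simp
  qed
qed

end

lemma hs_apply_simps [simp]:
  "hs_apply 0 x = 0"
  "hs_apply (A + B) x = hs_apply A x + hs_apply B x"
  "hs_apply (A - B) x = hs_apply A x - hs_apply B x"
  "hs_apply (- A) x = - hs_apply A x"
  "hs_apply (r *\<^sub>R A) x = r *\<^sub>R hs_apply A x"
  by (simp_all add: hs_apply_def blinfun_of_hs_simps blinfun.bilinear_simps)

lemma hs_eqI: "(\<And>x. hs_apply A x = hs_apply B x) \<Longrightarrow> A = B"
  by (simp add: hs_apply_def blinfun_eqI flip: blinfun_of_hs_inject)

lemma bounded_linear_hs_apply: "bounded_linear (hs_apply A)"
  unfolding hs_apply_def[abs_def] by (rule blinfun.bounded_linear_right)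

lemma has_sum_norm_hs: "((\<lambda>e. (norm (hs_apply A e))\<^sup>2) has_sum (norm A)\<^sup>2) some_onb"
proof -
  have "(norm A)\<^sup>2 = (\<Sum>\<^sub>\<infinity>e\<in>some_onb. (norm (hs_apply A e))\<^sup>2)"
    by (simp add: power2_norm_eq_inner inner_hs_def)
  then show ?thesis
    using hs_op_hs[of A] by (simp add: hs_apply_def)
qed

lemma hs_apply_expansion:
  "((\<lambda>e. inner x e *\<^sub>R hs_apply A e) has_sum hs_apply A x) some_onb"
  unfolding hs_apply_def by (rule blinfun_expansion)

lemma norm_hs_apply: "norm (hs_apply A x) \<le> norm A * norm x"
proof -
  have fin: "norm (\<Sum>e\<in>F. inner x e *\<^sub>R hs_apply A e) \<le> norm A * norm x"
    if F: "finite F" "F \<subseteq> some_onb" for F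
  proof -
    have "norm (\<Sum>e\<in>F. inner x e *\<^sub>R hs_apply A e) \<le> (\<Sum>e\<in>F. \<bar>norm (hs_apply A e)\<bar> * \<bar>inner x e\<bar>)"
      by (rule order_trans[OF norm_sum]) (simp add: mult.commute)
    also have "\<dots> \<le> L2_set (\<lambda>e. norm (hs_apply A e)) F * L2_set (\<lambda>e. inner x e) F"
      by (rule L2_set_mult_ineq)
    also have "\<dots> \<le> norm A * norm x"
    proof (rule mult_mono)
      have "(\<Sum>e\<in>F. (norm (hs_apply A e))\<^sup>2) \<le> (norm A)\<^sup>2"
        by (rule finite_sum_le_has_sum[OF has_sum_norm_hs]) (use F in auto)
      then show "L2_set (\<lambda>e. norm (hs_apply A e)) F \<le> norm A"
        unfolding L2_set_def by (intro real_le_lsqrt) (auto simp: sum_nonneg)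
      have "(\<Sum>e\<in>F. inner x e * inner x e) \<le> inner x x"
        by (rule finite_sum_le_has_sum[OF parseval_inner]) (use F in auto)
      then have "(\<Sum>e\<in>F. (inner x e)\<^sup>2) \<le> (norm x)\<^sup>2"
        by (simp add: power2_norm_eq_inner flip: power2_eq_square)
      then show "L2_set (\<lambda>e. inner x e) F \<le> norm x"
        unfolding L2_set_def by (intro real_le_lsqrt) (auto simp: sum_nonneg)
    qed (auto simp: L2_set_nonneg)
    finally show ?thesis .
  qed
  show ?thesis
  proof (rule tendsto_upperbound)
    show "((\<lambda>F. norm (\<Sum>e\<in>F. inner x e *\<^sub>R hs_apply A e)) \<longlongrightarrow> norm (hs_apply A x))
            (finite_subsets_at_top some_onb)"
      using hs_apply_expansion[of x A] unfolding has_sum_def by (rule tendsto_norm)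
    show "\<forall>\<^sub>F F in finite_subsets_at_top some_onb.
            norm (\<Sum>e\<in>F. inner x e *\<^sub>R hs_apply A e) \<le> norm A * norm x"
      by (rule eventually_finite_subsets_at_top_weakI) (rule fin)
  qed simp
qed

instance hs :: ("{real_inner, second_countable_topology}", "{real_inner, banach}") banach
proof
  fix X :: "nat \<Rightarrow> ('a, 'b) hs"
  assume X: "Cauchy X"
  have norm_le: "norm (blinfun_of_hs A) \<le> norm A" for A :: "('a, 'b) hs"
    by (rule norm_blinfun_bound) (use norm_hs_apply[of A] in \<open>simp_all add: hs_apply_def\<close>)
  have "Cauchy (\<lambda>n. blinfun_of_hs (X n))"
  proof (rule CauchyI)
    fix e :: real assume "e > 0"
    then obtain M where M: "\<forall>m\<ge>M. \<forall>n\<ge>M. norm (X m - X n) < e"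
      using CauchyD[OF X] by blast
    have "norm (blinfun_of_hs (X m) - blinfun_of_hs (X n)) < e" if "m \<ge> M" "n \<ge> M" for m n
    proof -
      have "norm (blinfun_of_hs (X m - X n)) < e"
        using M that by (intro le_less_trans[OF norm_le]) blast
      then show ?thesis
        by (simp only: blinfun_of_hs_simps)
    qed
    then show "\<exists>M. \<forall>m\<ge>M. \<forall>n\<ge>M. norm (blinfun_of_hs (X m) - blinfun_of_hs (X n)) < e"
      by blast
  qed
  then obtain A where A: "(\<lambda>n. blinfun_of_hs (X n)) \<longlonglongrightarrow> A"
    using convergent_eq_Cauchy by blast
  have key: "(\<Sum>e\<in>F. (norm (blinfun_apply (blinfun_of_hs (X n) - A) e))\<^sup>2) \<le> \<epsilon>\<^sup>2"
    if M: "\<forall>m\<ge>M. \<forall>n\<ge>M. norm (X m - X n) < \<epsilon>" and "n \<ge> M" and F: "finite F" "F \<subseteq> some_onb"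
    for M n \<epsilon> and F :: "'a set"
  proof (rule tendsto_upperbound)
    show "(\<lambda>m. \<Sum>e\<in>F. (norm (blinfun_apply (blinfun_of_hs (X n) - blinfun_of_hs (X m)) e))\<^sup>2)
            \<longlonglongrightarrow> (\<Sum>e\<in>F. (norm (blinfun_apply (blinfun_of_hs (X n) - A) e))\<^sup>2)"
      by (intro tendsto_intros A)
    show "\<forall>\<^sub>F m in sequentially.
      (\<Sum>e\<in>F. (norm (blinfun_apply (blinfun_of_hs (X n) - blinfun_of_hs (X m)) e))\<^sup>2) \<le> \<epsilon>\<^sup>2"
      using eventually_ge_at_top[of M]
    proof eventually_elim
      case (elim m)
      have "(\<Sum>e\<in>F. (norm (blinfun_apply (blinfun_of_hs (X n) - blinfun_of_hs (X m)) e))\<^sup>2)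
              = (\<Sum>e\<in>F. (norm (hs_apply (X n - X m) e))\<^sup>2)"
        by (simp add: hs_apply_def blinfun.diff_left blinfun_of_hs_simps)
      also have "\<dots> \<le> (norm (X n - X m))\<^sup>2"
        by (rule finite_sum_le_has_sum[OF has_sum_norm_hs]) (use F in auto)
      also have "\<dots> \<le> \<epsilon>\<^sup>2"
        using M elim \<open>n \<ge> M\<close> by (intro power_mono) (auto intro: less_imp_le)
      finally show ?case .
    qed
  qed simp
  have summ: "hs_op (blinfun_of_hs (X n) - A)"
    if M: "\<forall>m\<ge>M. \<forall>n\<ge>M. norm (X m - X n) < \<epsilon>" and "n \<ge> M" for M n \<epsilon>
  proof (rule nonneg_bdd_above_summable_on)
    show "bdd_above (sum (\<lambda>e. (norm (blinfun_apply (blinfun_of_hs (X n) - A) e))\<^sup>2) `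
            {F. F \<subseteq> some_onb \<and> finite F})"
      using key[OF M \<open>n \<ge> M\<close>] by (intro bdd_aboveI2[where M = "\<epsilon>\<^sup>2"]) auto
  qed simp
  obtain M0 where M0: "\<forall>m\<ge>M0. \<forall>n\<ge>M0. norm (X m - X n) < 1"
    using CauchyD[OF X, of 1] by auto
  have "hs_op (blinfun_of_hs (X M0) - (blinfun_of_hs (X M0) - A))"
    by (rule hs_op_diff[OF hs_op_hs summ[OF M0]]) simp
  then have "hs_op A"
    by simp
  then obtain L where L: "blinfun_of_hs L = A"
    using Abs_hs_inverse[of A] by blast
  have "X \<longlonglongrightarrow> L"
  proof (rule LIMSEQ_I)
    fix r :: real assume "r > 0"
    then obtain M where M: "\<forall>m\<ge>M. \<forall>n\<ge>M. norm (X m - X n) < r / 2"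
      using CauchyD[OF X, of "r / 2"] by auto
    have "norm (X n - L) < r" if "n \<ge> M" for n
    proof -
      have "(norm (X n - L))\<^sup>2 \<le> (r / 2)\<^sup>2"
      proof (rule has_sum_le_finite_sums[OF has_sum_norm_hs])
        fix F :: "'a set" assume F: "finite F" "F \<subseteq> some_onb"
        show "(\<Sum>e\<in>F. (norm (hs_apply (X n - L) e))\<^sup>2) \<le> (r / 2)\<^sup>2"
          using key[OF M that F] by (simp only: hs_apply_def blinfun_of_hs_simps L)
      qed
      then have "norm (X n - L) \<le> r / 2"
        by (rule power2_le_imp_le) (use \<open>r > 0\<close> in simp)
      then show ?thesis
        using \<open>r > 0\<close> by simp
    qed
    then show "\<exists>no. \<forall>n\<ge>no. norm (X n - L) < r"
      by blast
  qed
  then show "convergent X"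
    by (rule convergentI)
qed

text \<open>
  The tensor \<open>u \<otimes> v\<close> regarded as the Hilbert--Schmidt operator \<open>x \<mapsto> \<langle>v, x\<rangle> u\<close>.
\<close>

definition rank_one :: "'b::real_inner \<Rightarrow> 'a::{real_inner, second_countable_topology} \<Rightarrow> ('a, 'b) hs" where
  "rank_one u v = Abs_hs (Blinfun (\<lambda>x. inner v x *\<^sub>R u))"

lemma hs_apply_rank_one [simp]: "hs_apply (rank_one u v) x = inner v x *\<^sub>R u"
proof -
  have bl: "bounded_linear (\<lambda>x. inner v x *\<^sub>R u)"
    by (intro bounded_linear_scaleR_const bounded_linear_inner_right)
  have "(\<lambda>e. (inner v e)\<^sup>2 * (norm u)\<^sup>2) summable_on some_onb"
    using parseval_inner[of v v]
    by (intro summable_on_cmult_left) (auto simp: summable_on_def power2_eq_square)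
  then have "hs_op (Blinfun (\<lambda>x. inner v x *\<^sub>R u))"
    by (simp add: bounded_linear_Blinfun_apply[OF bl] power_mult_distrib)
  then have "blinfun_of_hs (rank_one u v) = Blinfun (\<lambda>x. inner v x *\<^sub>R u)"
    unfolding rank_one_def by (intro Abs_hs_inverse) blast
  then show ?thesis
    by (simp add: hs_apply_def bounded_linear_Blinfun_apply[OF bl])
qed

lemma inner_rank_one: "inner (rank_one u v) (rank_one u' v') = inner u u' * inner v v'"
proof -
  have "((\<lambda>e. (inner v e * inner v' e) * inner u u') has_sum inner v v' * inner u u') some_onb"
    by (intro has_sum_cmult_left parseval_inner)
  then have "(\<Sum>\<^sub>\<infinity>e\<in>some_onb. (inner v e * inner v' e) * inner u u') = inner v v' * inner u u'"
    by (rule infsumI)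
  then show ?thesis
    by (simp add: inner_hs_def mult_ac)
qed

lemma norm_rank_one: "norm (rank_one u v) = norm u * norm v"
  by (simp add: norm_eq_sqrt_inner inner_rank_one real_sqrt_mult)

lemma bilinear_rank_one: "bilinear rank_one"
  unfolding bilinear_def
  by (auto intro!: linearI hs_eqI simp: scaleR_add_left scaleR_add_right inner_add_left)

lemma hs_apply_sum: "hs_apply (\<Sum>i\<in>I. f i) x = (\<Sum>i\<in>I. hs_apply (f i) x)"
  by (induction I rule: infinite_finite_induct) auto

lemma hs_rank_one_expansion:
  "((\<lambda>e. rank_one (hs_apply A e) e) has_sum A) some_onb"
  unfolding has_sum_def tendsto_iff eventually_finite_subsets_at_top
proof (intro allI impI)
  fix \<epsilon> :: real assume "\<epsilon> > 0"
  then have "\<epsilon>\<^sup>2 / 2 > 0" "\<epsilon>\<^sup>2 / 2 < \<epsilon>\<^sup>2"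
    by simp_all
  have "((\<lambda>F. \<Sum>e\<in>F. (norm (hs_apply A e))\<^sup>2) \<longlongrightarrow> (norm A)\<^sup>2) (finite_subsets_at_top some_onb)"
    using has_sum_norm_hs[of A] by (simp add: has_sum_def)
  then have "\<forall>\<^sub>F F in finite_subsets_at_top some_onb.
      dist (\<Sum>e\<in>F. (norm (hs_apply A e))\<^sup>2) ((norm A)\<^sup>2) < \<epsilon>\<^sup>2 / 2"
    using \<open>\<epsilon>\<^sup>2 / 2 > 0\<close> by (rule tendstoD)
  then obtain F where F: "finite F" "F \<subseteq> some_onb"
    "\<And>G. finite G \<Longrightarrow> F \<subseteq> G \<Longrightarrow> G \<subseteq> some_onb \<Longrightarrow>
       dist (\<Sum>e\<in>G. (norm (hs_apply A e))\<^sup>2) ((norm A)\<^sup>2) < \<epsilon>\<^sup>2 / 2"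
    unfolding eventually_finite_subsets_at_top by auto
  show "\<exists>F. finite F \<and> F \<subseteq> some_onb \<and>
    (\<forall>G. finite G \<and> F \<subseteq> G \<and> G \<subseteq> some_onb \<longrightarrow> dist (\<Sum>e\<in>G. rank_one (hs_apply A e) e) A < \<epsilon>)"
  proof (intro exI[of _ F] conjI allI impI F(1,2))
    fix G assume G: "finite G \<and> F \<subseteq> G \<and> G \<subseteq> some_onb"
    define D where "D = A - (\<Sum>e\<in>G. rank_one (hs_apply A e) e)"
    have D: "hs_apply D f = (if f \<in> G then 0 else hs_apply A f)" if "f \<in> some_onb" for f
    proof -
      have "(\<Sum>e\<in>G. inner e f *\<^sub>R hs_apply A e) = (\<Sum>e\<in>G. if e = f then hs_apply A e else 0)"
        by (rule sum.cong) (use G that in \<open>auto simp: some_onb_inner subset_iff\<close>)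
      also have "\<dots> = (if f \<in> G then hs_apply A f else 0)"
        using G by simp
      finally show ?thesis
        by (simp add: D_def hs_apply_sum)
    qed
    have "(norm D)\<^sup>2 \<le> \<epsilon>\<^sup>2 / 2"
    proof (rule has_sum_le_finite_sums[OF has_sum_norm_hs])
      fix H :: "'a set" assume H: "finite H" "H \<subseteq> some_onb"
      have "(\<Sum>e\<in>H. (norm (hs_apply D e))\<^sup>2) = (\<Sum>e\<in>H - G. (norm (hs_apply A e))\<^sup>2)"
        by (rule sum.mono_neutral_cong_right) (use H D in auto)
      moreover have "(\<Sum>e\<in>G \<union> (H - G). (norm (hs_apply A e))\<^sup>2)
          = (\<Sum>e\<in>G. (norm (hs_apply A e))\<^sup>2) + (\<Sum>e\<in>H - G. (norm (hs_apply A e))\<^sup>2)"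
        using G H by (intro sum.union_disjoint) auto
      moreover have "(\<Sum>e\<in>G \<union> (H - G). (norm (hs_apply A e))\<^sup>2) \<le> (norm A)\<^sup>2"
        by (rule finite_sum_le_has_sum[OF has_sum_norm_hs]) (use G H in auto)
      moreover have "(norm A)\<^sup>2 - (\<Sum>e\<in>G. (norm (hs_apply A e))\<^sup>2) < \<epsilon>\<^sup>2 / 2"
      proof -
        have "\<bar>(\<Sum>e\<in>G. (norm (hs_apply A e))\<^sup>2) - (norm A)\<^sup>2\<bar> < \<epsilon>\<^sup>2 / 2"
          using F(3)[of G] G unfolding dist_real_def by blast
        then show ?thesis
          by linarith
      qed
      ultimately show "(\<Sum>e\<in>H. (norm (hs_apply D e))\<^sup>2) \<le> \<epsilon>\<^sup>2 / 2"
        by linarith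
    qed
    then have "(norm D)\<^sup>2 < \<epsilon>\<^sup>2"
      using \<open>\<epsilon>\<^sup>2 / 2 < \<epsilon>\<^sup>2\<close> by linarith
    then have "norm D < \<epsilon>"
      by (rule power2_less_imp_less) (use \<open>\<epsilon> > 0\<close> in simp)
    then show "dist (\<Sum>e\<in>G. rank_one (hs_apply A e) e) A < \<epsilon>"
      by (simp add: dist_norm norm_minus_commute D_def)
  qed
qed

lemma countable_dense_imp_second_countable:
  fixes D :: "'a::metric_space set"
  assumes "countable D" "closure D = UNIV"
  shows "\<exists>\<B>::'a set set. countable \<B> \<and> open = generate_topology \<B>"
proof (intro exI conjI)
  define \<B> where "\<B> = (\<lambda>(d, n). ball d (inverse (real (Suc n)))) ` (D \<times> (UNIV :: nat set))"
  show "countable \<B>"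
    unfolding \<B>_def using assms(1) by (intro countable_image countable_SIGMA) auto
  have "topological_basis \<B>"
  proof (rule topological_basisI)
    show "open U" if "U \<in> \<B>" for U
      using that by (auto simp: \<B>_def)
  next
    fix U and x :: 'a assume "open U" "x \<in> U"
    then obtain r where r: "r > 0" "ball x r \<subseteq> U"
      using open_contains_ball by blast
    obtain n where n: "inverse (real (Suc n)) < r / 2"
      using r(1) reals_Archimedean[of "r / 2"] by auto
    have "x \<in> closure D"
      using assms(2) by simp
    then obtain d where d: "d \<in> D" "dist d x < inverse (real (Suc n))"
      using closure_approachable[of x D] by (metis inverse_positive_iff_positive of_nat_0_less_iff zero_less_Suc)
    have "ball d (inverse (real (Suc n))) \<subseteq> ball x r"
    proof
      fix y assume "y \<in> ball d (inverse (real (Suc n)))"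
      then show "y \<in> ball x r"
        using d(2) n dist_triangle[of x y d] by (simp add: dist_commute)
    qed
    moreover have "ball d (inverse (real (Suc n))) \<in> \<B>"
      using d(1) by (auto simp: \<B>_def)
    moreover have "x \<in> ball d (inverse (real (Suc n)))"
      using d(2) by simp
    ultimately show "\<exists>B'\<in>\<B>. x \<in> B' \<and> B' \<subseteq> U"
      using r(2) by blast
  qed
  then show "open = generate_topology \<B>"
    by (rule topological_basis_imp_subbasis)
qed

instance hs :: ("{real_inner, second_countable_topology}", "{real_inner, second_countable_topology}")
  second_countable_topology
proof
  obtain D :: "'b set" where D: "countable D" "\<And>X. open X \<Longrightarrow> X \<noteq> {} \<Longrightarrow> \<exists>d\<in>D. d \<in> X"
    using countable_dense_setE by metis
  define S :: "('a, 'b) hs set" where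
    "S = (\<lambda>l. sum_list (map (\<lambda>(d, e). rank_one d e) l)) ` lists (D \<times> some_onb)"
  have "countable S"
    unfolding S_def by (intro countable_image countable_lists countable_SIGMA D(1) countable_some_onb)
  moreover have "A \<in> closure S" for A
    unfolding closure_approachable
  proof (intro allI impI)
    fix \<epsilon> :: real assume "\<epsilon> > 0"
    then have "\<forall>\<^sub>F F in finite_subsets_at_top some_onb.
        dist (\<Sum>e\<in>F. rank_one (hs_apply A e) e) A < \<epsilon> / 2"
      using hs_rank_one_expansion[of A] unfolding has_sum_def by (intro tendstoD) auto
    then obtain F where F: "finite F" "F \<subseteq> some_onb"
        "dist (\<Sum>e\<in>F. rank_one (hs_apply A e) e) A < \<epsilon> / 2"
      unfolding eventually_finite_subsets_at_top by auto
    define \<delta> where "\<delta> = \<epsilon> / (2 * (real (card F) + 1))"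
    have \<delta>: "\<delta> > 0" "real (card F) * \<delta> < \<epsilon> / 2"
      using \<open>\<epsilon> > 0\<close> by (simp_all add: \<delta>_def field_simps)
    have "\<exists>d\<in>D. d \<in> ball (hs_apply A e) \<delta>" for e
      using \<delta>(1) by (intro D(2)) auto
    then obtain d where d: "\<And>e. d e \<in> D" "\<And>e. dist (hs_apply A e) (d e) < \<delta>"
      unfolding mem_ball by metis
    obtain l where l: "distinct l" "set l = F"
      using finite_distinct_list F(1) by blast
    have "(\<Sum>e\<in>F. rank_one (d e) e) = sum_list (map (\<lambda>(d, e). rank_one d e) (map (\<lambda>e. (d e, e)) l))"
      using l by (simp add: sum_list_distinct_conv_sum_set o_def)
    moreover have "map (\<lambda>e. (d e, e)) l \<in> lists (D \<times> some_onb)"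
      using l F(2) d(1) by auto
    ultimately have mem: "(\<Sum>e\<in>F. rank_one (d e) e) \<in> S"
      unfolding S_def by blast
    have "dist (\<Sum>e\<in>F. rank_one (d e) e) (\<Sum>e\<in>F. rank_one (hs_apply A e) e)
        \<le> (\<Sum>e\<in>F. dist (rank_one (d e) e) (rank_one (hs_apply A e) e))"
      unfolding dist_norm sum_subtractf[symmetric] by (rule norm_sum)
    also have "\<dots> \<le> (\<Sum>e\<in>F. \<delta>)"
    proof (rule sum_mono)
      fix e assume "e \<in> F"
      then have "norm e = 1"
        using F(2) some_onb_inner[of e e] by (auto simp: norm_eq_sqrt_inner)
      have "rank_one (d e) e - rank_one (hs_apply A e) e = rank_one (d e - hs_apply A e) e"
        by (rule hs_eqI) (simp add: scaleR_diff_right)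
      then have "dist (rank_one (d e) e) (rank_one (hs_apply A e) e) = dist (hs_apply A e) (d e)"
        using \<open>norm e = 1\<close> by (simp add: dist_norm norm_rank_one norm_minus_commute)
      then show "dist (rank_one (d e) e) (rank_one (hs_apply A e) e) \<le> \<delta>"
        using d(2)[of e] by simp
    qed
    also have "\<dots> < \<epsilon> / 2"
      using \<delta>(2) by simp
    finally have "dist (\<Sum>e\<in>F. rank_one (d e) e) A < \<epsilon>"
      using F(3) dist_triangle[of "\<Sum>e\<in>F. rank_one (d e) e" A "\<Sum>e\<in>F. rank_one (hs_apply A e) e"]
      by linarith
    then show "\<exists>B\<in>S. dist B A < \<epsilon>"
      using mem by blast
  qed
  ultimately show "\<exists>\<B>::('a, 'b) hs set set. countable \<B> \<and> open = generate_topology \<B>"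
    by (intro countable_dense_imp_second_countable[of S]) auto
qed

text \<open>
  The Hilbert space tensor product, given by its characterization up to isometric isomorphism:
  a space \<open>'h\<close> with a bilinear map \<open>tens\<close> that is multiplicative for inner products and whose
  simple tensors span a dense subspace. Lemma \<open>hilbert_tensor_rank_one\<close> provides a model for
  any two spaces.
\<close>

locale hilbert_tensor =
  fixes tens :: "'a::{real_inner, banach, second_countable_topology} \<Rightarrow>
      'b::{real_inner, banach, second_countable_topology} \<Rightarrow>
      'h::{real_inner, banach, second_countable_topology}"
  assumes bilinear_tens: "bilinear tens"
    and inner_tens: "inner (tens x y) (tens x' y') = inner x x' * inner y y'"
    and dense_tens: "closure (span (range (\<lambda>(x, y). tens x y))) = UNIV"

lemma hilbert_tensor_rank_one:
  "hilbert_tensor (rank_one :: 'a::{real_inner, banach, second_countable_topology} \<Rightarrow>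
     'b::{real_inner, banach, second_countable_topology} \<Rightarrow> ('b, 'a) hs)"
proof
  show "closure (span (range (\<lambda>(x, y). rank_one x y :: ('b, 'a) hs))) = UNIV"
  proof (intro equalityI subset_UNIV subsetI)
    fix A :: "('b, 'a) hs"
    show "A \<in> closure (span (range (\<lambda>(x, y). rank_one x y)))"
    proof (rule Lim_in_closed_set)
      show "((\<lambda>F. \<Sum>e\<in>F. rank_one (hs_apply A e) e) \<longlongrightarrow> A) (finite_subsets_at_top some_onb)"
        using hs_rank_one_expansion[of A] by (simp add: has_sum_def)
      show "\<forall>\<^sub>F F in finite_subsets_at_top some_onb.
          (\<Sum>e\<in>F. rank_one (hs_apply A e) e) \<in> closure (span (range (\<lambda>(x, y). rank_one x y)))"
        by (intro always_eventually allI closure_subset[THEN subsetD] span_sum span_base) auto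
    qed simp_all
  qed
qed (simp_all add: bilinear_rank_one inner_rank_one)

text \<open>
  The operator \<open>A \<otimes>~ B\<close>. If \<open>hilbert_tensor tens\<close> holds, an operator with the defining property
  exists and is unique.
\<close>

definition tensor_op ::
  "('a::{real_inner, banach, second_countable_topology} \<Rightarrow>
    'b::{real_inner, banach, second_countable_topology} \<Rightarrow>
    'h::{real_inner, banach, second_countable_topology}) \<Rightarrow>
    ('a, 'a) hs \<Rightarrow> ('b, 'b) hs \<Rightarrow> ('h, 'h) hs" where
  "tensor_op tens A B =
     (THE T. \<forall>x y. hs_apply T (tens x y) = tens (hs_apply A x) (hs_apply B y))"

text \<open>
  Sequences are indexed from 1; their values at 0 are irrelevant. As in any singular value
  decomposition, orthonormality is imposed on the singular vectors with nonzero score, and the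
  \<open>A j\<close>, \<open>B j\<close> with score zero are unconstrained. Expansions along complete orthonormal bases are
  a special case; completeness cannot be demanded in general, because the spaces may be finite
  dimensional, have different dimensions, or contain vectors orthogonal to all of the infinitely
  many singular vectors with nonzero score.
\<close>

definition separable_expansion ::
  "('a::{real_inner, banach, second_countable_topology} \<Rightarrow>
    'b::{real_inner, banach, second_countable_topology} \<Rightarrow>
    'h::{real_inner, banach, second_countable_topology}) \<Rightarrow>
    ('h, 'h) hs \<Rightarrow> (nat \<Rightarrow> real) \<Rightarrow> (nat \<Rightarrow> ('a, 'a) hs) \<Rightarrow> (nat \<Rightarrow> ('b, 'b) hs) \<Rightarrow> bool" where
  "separable_expansion tens G \<sigma> A B \<longleftrightarrow>
     (\<forall>j\<ge>1. 0 \<le> \<sigma> j \<and> \<sigma> (j + 1) \<le> \<sigma> j) \<and>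
     orthonormal_family {j. 1 \<le> j \<and> \<sigma> j \<noteq> 0} A \<and>
     orthonormal_family {j. 1 \<le> j \<and> \<sigma> j \<noteq> 0} B \<and>
     (\<lambda>j. \<sigma> (j + 1) *\<^sub>R tensor_op tens (A (j + 1)) (B (j + 1))) sums G"

text \<open>
  \<open>DoS(G) \<le> R\<close>. Every \<open>G\<close> has a separable expansion and its scores do not depend on the
  expansion, so it does not matter which one is used.
\<close>

definition DoS_le ::
  "('a::{real_inner, banach, second_countable_topology} \<Rightarrow>
    'b::{real_inner, banach, second_countable_topology} \<Rightarrow>
    'h::{real_inner, banach, second_countable_topology}) \<Rightarrow> ('h, 'h) hs \<Rightarrow> nat \<Rightarrow> bool" where
  "DoS_le tens G R \<longleftrightarrow>
     (\<exists>\<sigma> A B. separable_expansion tens G \<sigma> A B \<and>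
        finite {j. 1 \<le> j \<and> \<sigma> j \<noteq> 0} \<and> card {j. 1 \<le> j \<and> \<sigma> j \<noteq> 0} \<le> R)"

text \<open>Formulated as a predicate because the minimizer is not unique when scores coincide.\<close>

definition best_separable_approx ::
  "('a::{real_inner, banach, second_countable_topology} \<Rightarrow>
    'b::{real_inner, banach, second_countable_topology} \<Rightarrow>
    'h::{real_inner, banach, second_countable_topology}) \<Rightarrow>
    nat \<Rightarrow> ('h, 'h) hs \<Rightarrow> ('h, 'h) hs \<Rightarrow> bool" where
  "best_separable_approx tens R F G \<longleftrightarrow>
     is_arg_min (\<lambda>G. (norm (F - G))\<^sup>2) (\<lambda>G. DoS_le tens G R) G"

definition covariance ::
  "'w measure \<Rightarrow> ('w \<Rightarrow> 'h::{real_inner, banach, second_countable_topology}) \<Rightarrow> ('h, 'h) hs" where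
  "covariance M X =
     (let m = integral\<^sup>L M X in integral\<^sup>L M (\<lambda>\<omega>. rank_one (X \<omega> - m) (X \<omega> - m)))"

definition empirical_mean ::
  "(nat \<Rightarrow> 'w \<Rightarrow> 'h::real_vector) \<Rightarrow> nat \<Rightarrow> 'w \<Rightarrow> 'h" where
  "empirical_mean X N \<omega> = (1 / real N) *\<^sub>R (\<Sum>n=1..N. X n \<omega>)"

definition empirical_covariance ::
  "(nat \<Rightarrow> 'w \<Rightarrow> 'h::{real_inner, banach, second_countable_topology}) \<Rightarrow> nat \<Rightarrow> 'w \<Rightarrow> ('h, 'h) hs" where
  "empirical_covariance X N \<omega> =
     (1 / real N) *\<^sub>R (\<Sum>n=1..N. rank_one (X n \<omega> - empirical_mean X N \<omega>) (X n \<omega> - empirical_mean X N \<omega>))"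

text \<open>\<open>Z\<^sub>N = O\<^sub>P(r\<^sub>N)\<close> as \<open>N \<rightarrow> \<infinity>\<close>.\<close>

definition bigo_prob :: "'w measure \<Rightarrow> (nat \<Rightarrow> 'w \<Rightarrow> real) \<Rightarrow> (nat \<Rightarrow> real) \<Rightarrow> bool" where
  "bigo_prob M Z r \<longleftrightarrow>
     (\<forall>N. Z N \<in> borel_measurable M) \<and>
     (\<forall>\<epsilon>>0. \<exists>K. \<forall>\<^sub>F N in sequentially. measure M {\<omega> \<in> space M. \<bar>Z N \<omega>\<bar> > K * \<bar>r N\<bar>} < \<epsilon>)"

text \<open>The convention \<open>\<sigma>\<^sub>0 = \<infinity>\<close> is built into the case \<open>i = 1\<close>.\<close>

definition score_gap :: "(nat \<Rightarrow> real) \<Rightarrow> nat \<Rightarrow> real" where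
  "score_gap \<sigma> i =
     (if i = 1 then (\<sigma> 1)\<^sup>2 - (\<sigma> 2)\<^sup>2
      else min ((\<sigma> (i - 1))\<^sup>2 - (\<sigma> i)\<^sup>2) ((\<sigma> i)\<^sup>2 - (\<sigma> (i + 1))\<^sup>2))"

end

theory Submission
  imports Defs
begin

text \<open>
  Let \<open>C\<^sub>R\<close> be the truncation of the separable expansion of \<open>C\<close> after \<open>R\<close> terms. Since
  \<open>DoS(C\<^sub>R) \<le> R\<close>, the minimizer \<open>C_hat N\<close> is at most as far from the empirical covariance as
  \<open>C\<^sub>R\<close>, and two triangle inequalities bound \<open>norm (C_hat N - C)\<close> by \<open>norm (C - C\<^sub>R)\<close> plus twice
  the error of the empirical covariance; no perturbation theory for singular vectors is needed.
  The first term is the square root of the tail sum, because \<open>A \<otimes>~ B\<close> is multiplicative for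
  Hilbert--Schmidt inner products. The second term is \<open>O\<^sub>P(1 / \<surd>N)\<close>: the empirical covariance is
  the average of the i.i.d. operators \<open>(X\<^sub>n - m) \<otimes> (X\<^sub>n - m)\<close> minus the square of the centered
  empirical mean, and the variance of an average of \<open>N\<close> independent vectors is of order \<open>1 / N\<close>.
  For \<open>R \<ge> 1\<close> the constant \<open>a_R\<close> is positive and may be inserted into the rate; for \<open>R = 0\<close> it
  vanishes, but then \<open>C_hat N = 0\<close> and there is no remainder at all.
\<close>

section \<open>Tensor products of Hilbert--Schmidt operators\<close>

lemma bounded_bilinear_if_norm_mult:
  assumes "bilinear f" "\<And>x y. norm (f x y) = norm x * norm y"
  shows "bounded_bilinear f"
proof
  show "\<exists>K. \<forall>a b. norm (f a b) \<le> norm a * norm b * K"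
    using assms(2) by (intro exI[of _ 1]) simp
qed (simp_all add: assms(1) bilinear_ladd bilinear_radd bilinear_lmul bilinear_rmul)

lemma bounded_bilinear_rank_one: "bounded_bilinear rank_one"
  using bilinear_rank_one norm_rank_one by (rule bounded_bilinear_if_norm_mult)

text \<open>Expanding \<open>T\<close> into rank-one operators along \<open>some_onb\<close>, and
  \<open>hs_apply T v\<close> along the same basis, turns both sides into the same series. Pairing
  with a rank-one operator thus reads off a matrix coefficient of \<open>T\<close>.\<close>

lemma inner_hs_rank_one: "inner T (rank_one u v) = inner (hs_apply T v) u"
proof -
  have "((\<lambda>e. inner (rank_one u v) (rank_one (hs_apply T e) e)) has_sum inner (rank_one u v) T) some_onb"
    using has_sum_bounded_linear[OF bounded_linear_inner_right hs_rank_one_expansion[of T]]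
    by (simp add: o_def)
  moreover have "((\<lambda>e. inner u (inner v e *\<^sub>R hs_apply T e)) has_sum inner u (hs_apply T v)) some_onb"
    using has_sum_bounded_linear[OF bounded_linear_inner_right hs_apply_expansion[of v T]]
    by (simp add: o_def)
  ultimately show ?thesis
    using has_sum_unique by (fastforce simp: inner_rank_one inner_commute mult.commute)
qed

text \<open>The basis expansion converges along the net of finite subsets; passing through the
  closure extracts a sequence, the form in which the Cauchy criterion is applied below.\<close>

lemma hs_finite_rank_approx:
  obtains F where "\<And>n. finite (F n)"
    "(\<lambda>n. \<Sum>e\<in>F n. rank_one (hs_apply A e) e) \<longlonglongrightarrow> A"
proof -
  define S where "S = (\<lambda>F. \<Sum>e\<in>F. rank_one (hs_apply A e) e) ` Collect finite"
  have "A \<in> closure S"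
  proof (rule Lim_in_closed_set)
    show "((\<lambda>F. \<Sum>e\<in>F. rank_one (hs_apply A e) e) \<longlongrightarrow> A) (finite_subsets_at_top some_onb)"
      using hs_rank_one_expansion[of A] by (simp add: has_sum_def)
    show "\<forall>\<^sub>F F in finite_subsets_at_top some_onb. (\<Sum>e\<in>F. rank_one (hs_apply A e) e) \<in> closure S"
      by (intro eventually_finite_subsets_at_top_weakI closure_subset[THEN subsetD]) (auto simp: S_def)
  qed simp_all
  then obtain s where s: "\<And>n. s n \<in> S" "s \<longlonglongrightarrow> A"
    unfolding closure_sequential by blast
  have "\<exists>F. finite F \<and> s n = (\<Sum>e\<in>F. rank_one (hs_apply A e) e)" for n
    using s(1)[of n] unfolding S_def by blast
  then obtain F where F: "\<And>n. finite (F n)" "\<And>n. s n = (\<Sum>e\<in>F n. rank_one (hs_apply A e) e)"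
    by metis
  show thesis
    by (rule that[OF F(1)]) (use s(2) in \<open>simp flip: F(2)\<close>)
qed

context hilbert_tensor
begin

lemma norm_tens: "norm (tens x y) = norm x * norm y"
  by (simp add: norm_eq_sqrt_inner inner_tens real_sqrt_mult)

sublocale bounded_bilinear tens
  using bilinear_tens norm_tens by (rule bounded_bilinear_if_norm_mult)

abbreviation is_tensor_op :: "('a, 'a) hs \<Rightarrow> ('b, 'b) hs \<Rightarrow> ('h, 'h) hs \<Rightarrow> bool" where
  "is_tensor_op A B T \<equiv> \<forall>x y. hs_apply T (tens x y) = tens (hs_apply A x) (hs_apply B y)"

text \<open>Agreement on simple tensors extends to their span by linearity and to its closure by
  continuity, and simple tensors span a dense subspace.\<close>

lemma is_tensor_op_unique:
  assumes "is_tensor_op A B T" "is_tensor_op A B T'"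
  shows "T = T'"
proof (rule hs_eqI)
  fix z
  note bl = bounded_linear_hs_apply[of T] bounded_linear_hs_apply[of T']
  have "hs_apply T w = hs_apply T' w" if "w \<in> span (range (\<lambda>(x, y). tens x y))" for w
    using that by (rule linear_eq_on[OF bl[THEN bounded_linear.linear]]) (use assms in auto)
  moreover have "closed {w. hs_apply T w = hs_apply T' w}"
    by (intro closed_Collect_eq bl[THEN linear_continuous_on])
  ultimately have "closure (span (range (\<lambda>(x, y). tens x y))) \<subseteq> {w. hs_apply T w = hs_apply T' w}"
    by (intro closure_minimal) auto
  then show "hs_apply T z = hs_apply T' z"
    using dense_tens by blast
qed

text \<open>The tensor product of the finite-rank operators with terms
  \<open>rank_one (hs_apply A e) e\<close> and \<open>rank_one (hs_apply B f) f\<close>, multiplied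
  out so that its values and inner products are finite sums.\<close>

definition finite_tensor_op where
  "finite_tensor_op A F B G =
     (\<Sum>e\<in>F. \<Sum>f\<in>G. rank_one (tens (hs_apply A e) (hs_apply B f)) (tens e f))"

lemma is_tensor_op_finite:
  "is_tensor_op (\<Sum>e\<in>F. rank_one (hs_apply A e) e) (\<Sum>f\<in>G. rank_one (hs_apply B f) f)
     (finite_tensor_op A F B G)"
proof (intro allI)
  fix x y
  have "tens (\<Sum>e\<in>F. inner e x *\<^sub>R hs_apply A e) (\<Sum>f\<in>G. inner f y *\<^sub>R hs_apply B f)
      = (\<Sum>e\<in>F. \<Sum>f\<in>G. (inner e x * inner f y) *\<^sub>R tens (hs_apply A e) (hs_apply B f))"
    unfolding sum_left unfolding sum_right by (simp add: scaleR_left scaleR_right mult.commute)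
  then show "hs_apply (finite_tensor_op A F B G) (tens x y) =
      tens (hs_apply (\<Sum>e\<in>F. rank_one (hs_apply A e) e) x) (hs_apply (\<Sum>f\<in>G. rank_one (hs_apply B f) f) y)"
    by (simp add: finite_tensor_op_def hs_apply_sum inner_tens)
qed

text \<open>Pairing \<open>T\<close> with each rank-one term evaluates \<open>T\<close> at
  \<open>tens e f\<close>, where its defining property applies. As only one operator has finite
  rank, this serves both the Cauchy argument and the general formula
  \<open>inner_tensor_op\<close>.\<close>

lemma inner_finite_tensor_op:
  assumes "is_tensor_op A B T"
  shows "inner T (finite_tensor_op A' F B' G) =
    inner A (\<Sum>e\<in>F. rank_one (hs_apply A' e) e) * inner B (\<Sum>f\<in>G. rank_one (hs_apply B' f) f)"
  using assms
  by (simp add: finite_tensor_op_def inner_sum_right inner_hs_rank_one inner_tens sum_product)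

text \<open>Hilbert-Schmidt convergence implies pointwise convergence, and \<open>tens\<close> is
  jointly continuous, so the defining identity survives the limit.\<close>

lemma tendsto_is_tensor_op:
  assumes "\<And>n. is_tensor_op (A n) (B n) (T n)" "A \<longlonglongrightarrow> A'" "B \<longlonglongrightarrow> B'" "T \<longlonglongrightarrow> T'"
  shows "is_tensor_op A' B' T'"
proof (intro allI)
  fix x y
  have hs: "(\<lambda>n. hs_apply (S n) z) \<longlonglongrightarrow> hs_apply S' z" if "S \<longlonglongrightarrow> S'"
    for S S' and z :: "'k::{real_inner, banach, second_countable_topology}"
  proof (rule Lim_null_comparison[THEN LIM_zero_cancel])
    show "\<forall>\<^sub>F n in sequentially. norm (hs_apply (S n) z - hs_apply S' z) \<le> norm (S n - S') * norm z"
      by (metis (no_types, lifting) always_eventually hs_apply_simps(3) norm_hs_apply)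
    show "(\<lambda>n. norm (S n - S') * norm z) \<longlonglongrightarrow> 0"
      using that by (intro tendsto_mult_left_zero tendsto_norm_zero LIM_zero)
  qed
  have "(\<lambda>n. hs_apply (T n) (tens x y)) \<longlonglongrightarrow> tens (hs_apply A' x) (hs_apply B' y)"
    unfolding assms(1)[THEN spec, THEN spec] by (intro tendsto hs assms)
  then show "hs_apply T' (tens x y) = tens (hs_apply A' x) (hs_apply B' y)"
    using hs[OF assms(4)] LIMSEQ_unique by blast
qed

text \<open>Existence of the tensor product operator. The approximating sequences are part of the
  conclusion because \<open>inner_tensor_op\<close> passes to the limit along them.\<close>

lemma finite_tensor_op_limit:
  fixes A B
  obtains T F G where "is_tensor_op A B T"
    "(\<lambda>n. \<Sum>e\<in>F n. rank_one (hs_apply A e) e) \<longlonglongrightarrow> A"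
    "(\<lambda>n. \<Sum>f\<in>G n. rank_one (hs_apply B f) f) \<longlonglongrightarrow> B"
    "(\<lambda>n. finite_tensor_op A (F n) B (G n)) \<longlonglongrightarrow> T"
proof -
  obtain F where F: "(\<lambda>n. \<Sum>e\<in>F n. rank_one (hs_apply A e) e) \<longlonglongrightarrow> A"
    using hs_finite_rank_approx by blast
  obtain G where G: "(\<lambda>n. \<Sum>f\<in>G n. rank_one (hs_apply B f) f) \<longlonglongrightarrow> B"
    using hs_finite_rank_approx by blast
  define a where "a n = (\<Sum>e\<in>F n. rank_one (hs_apply A e) e)" for n
  define b where "b n = (\<Sum>f\<in>G n. rank_one (hs_apply B f) f)" for n
  define T where "T n = finite_tensor_op A (F n) B (G n)" for n
  have tensor: "is_tensor_op (a n) (b n) (T n)" for n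
    unfolding a_def b_def T_def by (rule is_tensor_op_finite)
  have inner: "inner (T m) (T n) = inner (a m) (a n) * inner (b m) (b n)" for m n
    using inner_finite_tensor_op[OF tensor] by (simp add: a_def b_def T_def)
  have "((\<lambda>p. norm (T (fst p) - T (snd p))) \<longlongrightarrow> 0) (sequentially \<times>\<^sub>F sequentially)"
  proof -
    have lim: "((\<lambda>p. c (fst p)) \<longlongrightarrow> l) (sequentially \<times>\<^sub>F sequentially)"
      "((\<lambda>p. c (snd p)) \<longlongrightarrow> l) (sequentially \<times>\<^sub>F sequentially)"
      if "c \<longlonglongrightarrow> l" for c :: "nat \<Rightarrow> 'k::topological_space" and l
      using that by (auto intro: filterlim_compose filterlim_fst filterlim_snd)
    \<comment> \<open>This is the squared norm of \<open>T m - T n\<close>, expanded by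
      multiplicativity. All inner products converge jointly in both indices to those of the limits,
      so the three terms cancel and \<open>T\<close> is Cauchy.\<close>
    have "((\<lambda>p. inner (a (fst p)) (a (fst p)) * inner (b (fst p)) (b (fst p))
        - 2 * (inner (a (fst p)) (a (snd p)) * inner (b (fst p)) (b (snd p)))
        + inner (a (snd p)) (a (snd p)) * inner (b (snd p)) (b (snd p)))
      \<longlongrightarrow> inner A A * inner B B - 2 * (inner A A * inner B B) + inner A A * inner B B)
      (sequentially \<times>\<^sub>F sequentially)"
      using F G unfolding a_def[symmetric] b_def[symmetric] by (intro tendsto_intros lim)
    then show ?thesis
      by (subst power_tendsto_0_iff[of 2, symmetric])
        (simp_all add: power2_norm_eq_inner inner_diff_left inner_diff_right inner
          inner_commute algebra_simps)
  qed
  then have "\<forall>\<^sub>F p in sequentially \<times>\<^sub>F sequentially. norm (T (fst p) - T (snd p)) < \<epsilon>" if "\<epsilon> > 0" for \<epsilon>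
    using that by (rule order_tendstoD(2))
  then have "\<exists>K. \<forall>m\<ge>K. \<forall>n\<ge>K. norm (T m - T n) < \<epsilon>" if "\<epsilon> > 0" for \<epsilon>
    using that by (simp add: eventually_prod_sequentially norm_minus_commute)
  then have "Cauchy T"
    by (rule CauchyI)
  then obtain T' where "T \<longlonglongrightarrow> T'"
    using convergent_eq_Cauchy by blast
  moreover have "is_tensor_op A B T'"
    using tensor F G \<open>T \<longlonglongrightarrow> T'\<close> unfolding a_def[symmetric] b_def[symmetric]
    by (rule tendsto_is_tensor_op)
  ultimately show thesis
    using that F G unfolding T_def by blast
qed

lemma tensor_op_eqI:
  assumes "is_tensor_op A B T"
  shows "tensor_op tens A B = T"
  unfolding tensor_op_def
proof (rule the_equality)
  show "is_tensor_op A B T"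
    by fact
  show "T' = T" if "is_tensor_op A B T'" for T'
    using that assms by (rule is_tensor_op_unique)
qed

lemma is_tensor_op: "is_tensor_op A B (tensor_op tens A B)"
proof -
  obtain T where T: "is_tensor_op A B T"
    by (rule finite_tensor_op_limit[of A B])
  then show ?thesis
    by (subst tensor_op_eqI[OF T])
qed

text \<open>\<open>inner_finite_tensor_op\<close> is the case of a finite-rank second operator;
  continuity of the inner product gives the rest.\<close>

lemma inner_tensor_op:
  "inner (tensor_op tens A B) (tensor_op tens A' B') = inner A A' * inner B B'"
proof -
  obtain T F G where T: "is_tensor_op A' B' T"
    and lim: "(\<lambda>n. \<Sum>e\<in>F n. rank_one (hs_apply A' e) e) \<longlonglongrightarrow> A'"
    "(\<lambda>n. \<Sum>f\<in>G n. rank_one (hs_apply B' f) f) \<longlonglongrightarrow> B'"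
    "(\<lambda>n. finite_tensor_op A' (F n) B' (G n)) \<longlonglongrightarrow> T"
    by (rule finite_tensor_op_limit)
  have "(\<lambda>n. inner (tensor_op tens A B) (finite_tensor_op A' (F n) B' (G n))) \<longlonglongrightarrow> inner A A' * inner B B'"
    unfolding inner_finite_tensor_op[OF is_tensor_op] by (intro tendsto_intros lim)
  moreover have "(\<lambda>n. inner (tensor_op tens A B) (finite_tensor_op A' (F n) B' (G n)))
      \<longlonglongrightarrow> inner (tensor_op tens A B) T"
    by (intro tendsto_intros lim)
  ultimately show ?thesis
    unfolding tensor_op_eqI[OF T] by (rule LIMSEQ_unique[symmetric])
qed

section \<open>Truncated separable expansions\<close>

text \<open>Pythagoras: the terms of the expansion are pairwise orthogonal, so the squared norms of
  the partial sums of the tail are sums of squared scores, and the norm is continuous.\<close>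

lemma separable_expansion_tail:
  assumes "separable_expansion tens G \<sigma> A B"
  shows "(\<lambda>i. (\<sigma> (R + 1 + i))\<^sup>2) sums
    (norm (G - (\<Sum>j<R. \<sigma> (j + 1) *\<^sub>R tensor_op tens (A (j + 1)) (B (j + 1)))))\<^sup>2"
proof -
  define t where "t j = \<sigma> (j + 1) *\<^sub>R tensor_op tens (A (j + 1)) (B (j + 1))" for j
  have inner_t: "inner (t i) (t j) = (if i = j then (\<sigma> (j + 1))\<^sup>2 else 0)" for i j
  \<comment> \<open>Orthonormality is available only at nonzero scores; at a zero score the term
    itself vanishes. The shift by one arises because scores are numbered from 1.\<close>
  proof (cases "\<sigma> (i + 1) = 0 \<or> \<sigma> (j + 1) = 0")
    case True
    then show ?thesis
      by (auto simp: t_def)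
  next
    case False
    then have "inner (A (i + 1)) (A (j + 1)) = (if i = j then 1 else 0)"
      "inner (B (i + 1)) (B (j + 1)) = (if i = j then 1 else 0)"
      using assms by (auto simp: separable_expansion_def orthonormal_family_def)
    then show ?thesis
      by (auto simp: t_def inner_tensor_op power2_eq_square)
  qed
  have "(\<lambda>j. t (j + R)) sums (G - (\<Sum>j<R. t j))"
    using assms by (intro sums_split_initial_segment) (simp add: separable_expansion_def t_def)
  then have "(\<lambda>n. (norm (\<Sum>j<n. t (j + R)))\<^sup>2) \<longlonglongrightarrow> (norm (G - (\<Sum>j<R. t j)))\<^sup>2"
    unfolding sums_def by (intro tendsto_intros)
  moreover have "(norm (\<Sum>j<n. t (j + R)))\<^sup>2 = (\<Sum>j<n. (\<sigma> (R + 1 + j))\<^sup>2)" for n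
    by (simp add: power2_norm_eq_inner inner_sum_left inner_sum_right inner_t algebra_simps)
  ultimately show ?thesis
    by (simp add: sums_def t_def)
qed

lemma DoS_le_truncation:
  assumes "separable_expansion tens G \<sigma> A B"
  shows "DoS_le tens (\<Sum>j<R. \<sigma> (j + 1) *\<^sub>R tensor_op tens (A (j + 1)) (B (j + 1))) R"
proof -
  \<comment> \<open>Cutting the scores off after \<open>R\<close> keeps them nonincreasing because
    they are nonnegative, and orthonormality is inherited by the smaller set of indices with nonzero
    score. Hence the same \<open>A\<close> and \<open>B\<close> expand the truncation.\<close>
  define \<tau> where "\<tau> j = (if j \<le> R then \<sigma> j else 0)" for j
  have sub: "{j. 1 \<le> j \<and> \<tau> j \<noteq> 0} \<subseteq> {1..R}"
    by (auto simp: \<tau>_def split: if_splits)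
  have "(\<lambda>j. \<tau> (j + 1) *\<^sub>R tensor_op tens (A (j + 1)) (B (j + 1))) sums
      (\<Sum>j<R. \<tau> (j + 1) *\<^sub>R tensor_op tens (A (j + 1)) (B (j + 1)))"
    by (rule sums_finite) (auto simp: \<tau>_def)
  moreover have "(\<Sum>j<R. \<tau> (j + 1) *\<^sub>R tensor_op tens (A (j + 1)) (B (j + 1)))
      = (\<Sum>j<R. \<sigma> (j + 1) *\<^sub>R tensor_op tens (A (j + 1)) (B (j + 1)))"
    by (rule sum.cong) (auto simp: \<tau>_def)
  ultimately have "separable_expansion tens
      (\<Sum>j<R. \<sigma> (j + 1) *\<^sub>R tensor_op tens (A (j + 1)) (B (j + 1))) \<tau> A B"
    using assms by (auto simp: separable_expansion_def orthonormal_family_def \<tau>_def)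
  moreover have "finite {j. 1 \<le> j \<and> \<tau> j \<noteq> 0}" "card {j. 1 \<le> j \<and> \<tau> j \<noteq> 0} \<le> R"
    using finite_subset[OF sub] card_mono[OF _ sub] by auto
  ultimately show ?thesis
    unfolding DoS_le_def by blast
qed

lemma DoS_le_0: "DoS_le tens G 0 \<Longrightarrow> G = 0"
proof -
  assume "DoS_le tens G 0"
  then obtain \<sigma> A B where "separable_expansion tens G \<sigma> A B" "\<forall>j\<ge>1. \<sigma> j = 0"
    unfolding DoS_le_def by auto
  then have "(\<lambda>j. 0) sums G"
    by (simp add: separable_expansion_def)
  then show "G = 0"
    using sums_unique2 sums_zero by blast
qed

lemma best_separable_approx_error:
  assumes "separable_expansion tens C \<sigma> A B" "best_separable_approx tens R F G"
  shows "norm (G - C) \<le> sqrt (\<Sum>i. (\<sigma> (R + 1 + i))\<^sup>2) + 2 * norm (F - C)"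
proof -
  define C\<^sub>R where "C\<^sub>R = (\<Sum>j<R. \<sigma> (j + 1) *\<^sub>R tensor_op tens (A (j + 1)) (B (j + 1)))"
  have tail: "sqrt (\<Sum>i. (\<sigma> (R + 1 + i))\<^sup>2) = norm (C - C\<^sub>R)"
    using sums_unique[OF separable_expansion_tail[OF assms(1), of R], symmetric] by (simp add: C\<^sub>R_def)
  have "(norm (F - G))\<^sup>2 \<le> (norm (F - C\<^sub>R))\<^sup>2"
    using assms(2) DoS_le_truncation[OF assms(1), of R]
    by (auto simp: best_separable_approx_def is_arg_min_def C\<^sub>R_def not_less)
  then have "norm (F - G) \<le> norm (F - C\<^sub>R)"
    by (rule power2_le_imp_le) simp
  then show ?thesis
    \<comment> \<open>The error \<open>F - C\<close> enters twice: on the way from \<open>G\<close>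
      to \<open>C\<close>, and on the way from \<open>F\<close> to the truncation. This is the
      factor 2.\<close>
    using tail norm_triangle_ineq[of "G - F" "F - C"] norm_triangle_ineq[of "F - C" "C - C\<^sub>R"]
    by (simp add: norm_minus_commute)
qed

lemma best_separable_approx_0_error:
  assumes "separable_expansion tens C \<sigma> A B" "best_separable_approx tens 0 F G"
  shows "norm (G - C) = sqrt (\<Sum>i. (\<sigma> (1 + i))\<^sup>2)"
proof -
  have "G = 0"
    using assms(2) by (auto simp: best_separable_approx_def is_arg_min_def intro: DoS_le_0)
  then show ?thesis
    using sums_unique[OF separable_expansion_tail[OF assms(1), of 0], symmetric] by simp
qed

end

section \<open>Second moments of averages in Hilbert spaces\<close>

lemma (in prob_space) indep_vars_imp_indep_var:
  assumes "indep_vars M' X I" "i \<in> I" "j \<in> I" "i \<noteq> j"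
  shows "indep_var (M' i) (X i) (M' j) (X j)"
proof -
  have "indep_var (PiM {i} M') (\<lambda>\<omega>. restrict (\<lambda>k. X k \<omega>) {i}) (PiM {j} M') (\<lambda>\<omega>. restrict (\<lambda>k. X k \<omega>) {j})"
    using assms by (intro indep_var_restrict) auto
  then have "indep_var (M' i) ((\<lambda>f. f i) \<circ> (\<lambda>\<omega>. restrict (\<lambda>k. X k \<omega>) {i}))
      (M' j) ((\<lambda>f. f j) \<circ> (\<lambda>\<omega>. restrict (\<lambda>k. X k \<omega>) {j}))"
    by (rule indep_var_compose) (auto intro: measurable_component_singleton)
  then show ?thesis
    by (simp add: o_def)
qed

text \<open>For \<open>t \<ge> 0\<close> and \<open>m \<le> n\<close>,
  \<open>t ^ m \<le> 1 + t ^ n\<close>, and constants are integrable for a finite measure.\<close>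

lemma integrable_norm_lower_power:
  fixes f :: "_ \<Rightarrow> 'h::{banach, second_countable_topology}"
  assumes "finite_measure M" "f \<in> borel_measurable M" "integrable M (\<lambda>\<omega>. norm (f \<omega>) ^ n)" "m \<le> n"
  shows "integrable M (\<lambda>\<omega>. norm (f \<omega>) ^ m)"
proof (rule Bochner_Integration.integrable_bound)
  show "integrable M (\<lambda>\<omega>. 1 + norm (f \<omega>) ^ n)"
    using assms by (simp add: finite_measure.integrable_const)
  show "(\<lambda>\<omega>. norm (f \<omega>) ^ m) \<in> borel_measurable M"
    using assms(2) by measurable
  have "norm (f \<omega>) ^ m \<le> 1 + norm (f \<omega>) ^ n" for \<omega>
  proof (cases "norm (f \<omega>) \<le> 1")
    case True
    then show ?thesis
      using power_le_one[of "norm (f \<omega>)" m] by (simp add: add_increasing2)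
  next
    case False
    then show ?thesis
      using power_increasing[OF assms(4), of "norm (f \<omega>)"] by linarith
  qed
  then show "AE \<omega> in M. norm (norm (f \<omega>) ^ m) \<le> norm (1 + norm (f \<omega>) ^ n)"
    by (simp add: add_nonneg_nonneg)
qed

lemma abs_inner_le_sum_power2: "\<bar>inner x y\<bar> \<le> (norm x)\<^sup>2 + (norm y)\<^sup>2"
proof -
  have "\<bar>inner x y\<bar> \<le> norm x * norm y"
    by (rule Cauchy_Schwarz_ineq2)
  also have "\<dots> \<le> (norm x)\<^sup>2 + (norm y)\<^sup>2"
    using sum_squares_bound[of "norm x" "norm y"] zero_le_power2[of "norm x"] zero_le_power2[of "norm y"]
    unfolding mult.assoc by linarith
  finally show ?thesis .
qed

lemma integrable_inner_of_power2:
  fixes U V :: "_ \<Rightarrow> 'h::{real_inner, banach, second_countable_topology}"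
  assumes [measurable]: "U \<in> borel_measurable M" "V \<in> borel_measurable M"
    and "integrable M (\<lambda>\<omega>. (norm (U \<omega>))\<^sup>2)" "integrable M (\<lambda>\<omega>. (norm (V \<omega>))\<^sup>2)"
  shows "integrable M (\<lambda>\<omega>. inner (U \<omega>) (V \<omega>))"
proof (rule Bochner_Integration.integrable_bound)
  show "integrable M (\<lambda>\<omega>. (norm (U \<omega>))\<^sup>2 + (norm (V \<omega>))\<^sup>2)"
    using assms by simp
  show "AE \<omega> in M. norm (inner (U \<omega>) (V \<omega>)) \<le> norm ((norm (U \<omega>))\<^sup>2 + (norm (V \<omega>))\<^sup>2)"
    by (simp add: abs_inner_le_sum_power2)
qed simp

text \<open>Independence makes the joint law a product, so Fubini applies, and the inner product,
  being linear and continuous in each argument, commutes with both Bochner integrals. The second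
  moments make it integrable.\<close>

lemma (in prob_space) indep_var_expectation_inner:
  fixes U V :: "'a \<Rightarrow> 'h::{real_inner, banach, second_countable_topology}"
  assumes indep: "indep_var borel U borel V"
    and U2: "integrable M (\<lambda>\<omega>. (norm (U \<omega>))\<^sup>2)" and V2: "integrable M (\<lambda>\<omega>. (norm (V \<omega>))\<^sup>2)"
  shows "expectation (\<lambda>\<omega>. inner (U \<omega>) (V \<omega>)) = inner (expectation U) (expectation V)"
proof -
  note [measurable] = indep_var_rv1[OF indep] indep_var_rv2[OF indep]
  have U1: "integrable M U" and V1: "integrable M V"
    using integrable_norm_lower_power[OF finite_measure_axioms _ U2, of 1]
      integrable_norm_lower_power[OF finite_measure_axioms _ V2, of 1]
    by (simp_all add: integrable_norm_iff)
  interpret U: prob_space "distr M borel U" by (rule prob_space_distr) simp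
  interpret V: prob_space "distr M borel V" by (rule prob_space_distr) simp
  interpret UV: pair_prob_space "distr M borel U" "distr M borel V" ..
  have UV: "distr M borel U \<Otimes>\<^sub>M distr M borel V = distr M (borel \<Otimes>\<^sub>M borel) (\<lambda>\<omega>. (U \<omega>, V \<omega>))"
    using indep by (simp add: indep_var_distribution_eq)
  have meas: "(\<lambda>p. inner (fst p) (snd p)) \<in> borel_measurable (borel \<Otimes>\<^sub>M (borel :: 'h measure))"
    by measurable
  have int: "integrable (distr M borel U \<Otimes>\<^sub>M distr M borel V) (\<lambda>p. inner (fst p) (snd p))"
    unfolding UV by (subst integrable_distr_eq[OF _ meas]) (simp_all add: integrable_inner_of_power2 U2 V2)
  have "expectation (\<lambda>\<omega>. inner (U \<omega>) (V \<omega>))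
      = (\<integral>p. inner (fst p) (snd p) \<partial>(distr M borel U \<Otimes>\<^sub>M distr M borel V))"
    unfolding UV by (subst integral_distr[OF _ meas]) simp_all
  also have "\<dots> = (\<integral>u. (\<integral>v. inner u v \<partial>distr M borel V) \<partial>distr M borel U)"
    using UV.integral_fst'[OF int] by simp
  also have "\<dots> = (\<integral>u. inner u (expectation V) \<partial>distr M borel U)"
    using V1 by (simp add: integral_distr)
  also have "\<dots> = inner (expectation U) (expectation V)"
    using U1 by (simp add: integral_distr)
  finally show ?thesis .
qed

text \<open>The off-diagonal expectations vanish by independence and centering, leaving
  \<open>N\<close> diagonal terms \<open>v\<close>. The factor \<open>real N\<close> makes the
  expectation independent of \<open>N\<close>, as the later use of Markov's inequality
  requires.\<close>

lemma (in prob_space) second_moment_average: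
  fixes W :: "nat \<Rightarrow> 'a \<Rightarrow> 'h::{real_inner, banach, second_countable_topology}"
  assumes indep: "indep_vars (\<lambda>_. borel) W {1..}"
    and int: "\<And>n. n \<ge> 1 \<Longrightarrow> integrable M (\<lambda>\<omega>. (norm (W n \<omega>))\<^sup>2)"
    and mean: "\<And>n. n \<ge> 1 \<Longrightarrow> expectation (W n) = 0"
    and var: "\<And>n. n \<ge> 1 \<Longrightarrow> expectation (\<lambda>\<omega>. (norm (W n \<omega>))\<^sup>2) = v"
    and "N \<ge> 1"
  shows "integrable M (\<lambda>\<omega>. real N * (norm ((1 / real N) *\<^sub>R (\<Sum>n=1..N. W n \<omega>)))\<^sup>2)"
    and "expectation (\<lambda>\<omega>. real N * (norm ((1 / real N) *\<^sub>R (\<Sum>n=1..N. W n \<omega>)))\<^sup>2) = v"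
proof -
  have rv: "random_variable borel (W n)" if "n \<ge> 1" for n
    using indep that by (auto simp: indep_vars_def)
  have eq: "real N * (norm ((1 / real N) *\<^sub>R (\<Sum>n=1..N. W n \<omega>)))\<^sup>2
      = (1 / real N) * (\<Sum>i=1..N. \<Sum>j=1..N. inner (W i \<omega>) (W j \<omega>))" for \<omega>
  proof -
    have "(norm (\<Sum>n=1..N. W n \<omega>))\<^sup>2 = (\<Sum>i=1..N. \<Sum>j=1..N. inner (W i \<omega>) (W j \<omega>))"
      unfolding power2_norm_eq_inner inner_sum_left unfolding inner_sum_right by (rule refl)
    then show ?thesis
      using \<open>N \<ge> 1\<close> by (simp add: power_mult_distrib power2_eq_square)
  qed
  have int_inner: "integrable M (\<lambda>\<omega>. inner (W i \<omega>) (W j \<omega>))" if "i \<ge> 1" "j \<ge> 1" for i j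
    using that by (intro integrable_inner_of_power2 rv int)
  then show "integrable M (\<lambda>\<omega>. real N * (norm ((1 / real N) *\<^sub>R (\<Sum>n=1..N. W n \<omega>)))\<^sup>2)"
    unfolding eq by (intro integrable_mult_right Bochner_Integration.integrable_sum) auto
  have exp_inner: "expectation (\<lambda>\<omega>. inner (W i \<omega>) (W j \<omega>)) = (if i = j then v else 0)"
    if "i \<ge> 1" "j \<ge> 1" for i j
  proof (cases "i = j")
    case True
    then show ?thesis
      using var[OF that(1)] by (simp add: power2_norm_eq_inner)
  next
    case False
    then have "indep_var borel (W i) borel (W j)"
      using indep_vars_imp_indep_var[OF indep] that by simp
    then show ?thesis
      using False that by (simp add: indep_var_expectation_inner int mean)
  qed
  have "expectation (\<lambda>\<omega>. \<Sum>i=1..N. \<Sum>j=1..N. inner (W i \<omega>) (W j \<omega>))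
      = (\<Sum>i=1..N. expectation (\<lambda>\<omega>. \<Sum>j=1..N. inner (W i \<omega>) (W j \<omega>)))"
    by (intro Bochner_Integration.integral_sum Bochner_Integration.integrable_sum int_inner) auto
  also have "\<dots> = (\<Sum>i=1..N. \<Sum>j=1..N. expectation (\<lambda>\<omega>. inner (W i \<omega>) (W j \<omega>)))"
    by (intro sum.cong refl Bochner_Integration.integral_sum int_inner) auto
  also have "\<dots> = (\<Sum>i=1..N. \<Sum>j=1..N. if i = j then v else 0)"
    by (simp add: exp_inner)
  also have "\<dots> = real N * v"
    by simp
  finally show "expectation (\<lambda>\<omega>. real N * (norm ((1 / real N) *\<^sub>R (\<Sum>n=1..N. W n \<omega>)))\<^sup>2) = v"
    unfolding eq using \<open>N \<ge> 1\<close> by simp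
qed

section \<open>The error of the empirical covariance\<close>

lemma empirical_covariance_centered:
  assumes "N \<ge> 1"
  shows "empirical_covariance X N \<omega> =
    (1 / real N) *\<^sub>R (\<Sum>n=1..N. rank_one (X n \<omega> - m) (X n \<omega> - m))
    - rank_one (empirical_mean X N \<omega> - m) (empirical_mean X N \<omega> - m)"
proof -
  interpret r: bounded_bilinear "rank_one :: 'a \<Rightarrow> 'a \<Rightarrow> ('a, 'a) hs"
    by (rule bounded_bilinear_rank_one)
  define d where "d = empirical_mean X N \<omega> - m"
  define x where "x n = X n \<omega> - m" for n
  have sum_x: "(\<Sum>n=1..N. x n) = real N *\<^sub>R d"
    using assms by (simp add: x_def d_def empirical_mean_def sum_subtractf scaleR_diff_right sum_constant_scaleR)
  have x_d: "X n \<omega> - empirical_mean X N \<omega> = x n - d" for n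
    by (simp add: x_def d_def)
  \<comment> \<open>Expand bilinearly around \<open>m\<close>. Since the \<open>x n\<close> sum to
    \<open>real N *\<^sub>R d\<close>, each of the two cross terms contributes minus
    \<open>N\<close> copies of \<open>rank_one d d\<close>, one of which cancels the last
    term.\<close>
  have "(\<Sum>n=1..N. rank_one (X n \<omega> - empirical_mean X N \<omega>) (X n \<omega> - empirical_mean X N \<omega>))
      = (\<Sum>n=1..N. rank_one (x n) (x n)) - rank_one (\<Sum>n=1..N. x n) d - rank_one d (\<Sum>n=1..N. x n)
        + real N *\<^sub>R rank_one d d"
    unfolding x_d r.diff_left r.diff_right sum_subtractf r.sum_left r.sum_right
    by (simp add: sum_constant_scaleR)
  also have "\<dots> = (\<Sum>n=1..N. rank_one (x n) (x n)) - real N *\<^sub>R rank_one d d"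
    by (simp only: sum_x r.scaleR_left r.scaleR_right) simp
  finally show ?thesis
    using assms by (simp add: empirical_covariance_def x_def d_def scaleR_diff_right)
qed

text \<open>The scaled error is dominated by a nonnegative variable whose expectation does not
  depend on \<open>N\<close>. \<open>Q N\<close> consists of the scaled squared norms of the
  averages of the centered operators and of the centered observations.\<close>

lemma (in prob_space) empirical_covariance_error:
  fixes X\<^sub>0 :: "'a \<Rightarrow> 'h::{real_inner, banach, second_countable_topology}"
  assumes X0 [measurable]: "X\<^sub>0 \<in> borel_measurable M"
    and indep: "indep_vars (\<lambda>_. borel) X {1..}"
    and distr: "\<And>n. n \<ge> 1 \<Longrightarrow> distr M borel (X n) = distr M borel X\<^sub>0"
    and int4: "integrable M (\<lambda>\<omega>. norm (X\<^sub>0 \<omega>) ^ 4)"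
  obtains Q v where "\<And>N. N \<ge> 1 \<Longrightarrow> integrable M (Q N)"
    "\<And>N. N \<ge> 1 \<Longrightarrow> expectation (Q N) = v" "\<And>N \<omega>. 0 \<le> Q N \<omega>"
    "\<And>N \<omega>. N \<ge> 1 \<Longrightarrow> sqrt (real N) * norm (empirical_covariance X N \<omega> - covariance M X\<^sub>0) \<le> 1 + Q N \<omega>"
proof -
  define m where "m = expectation X\<^sub>0"
  define C where "C = covariance M X\<^sub>0"
  define g where "g x = rank_one (x - m) (x - m) - C" for x
  have rank_meas: "(\<lambda>x. rank_one (x - m) (x - m)) \<in> borel_measurable borel"
    by (intro borel_measurable_continuous_onI bounded_bilinear.continuous_on[OF bounded_bilinear_rank_one]
        continuous_intros)
  then have g_meas [measurable]: "g \<in> borel_measurable borel"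
    unfolding g_def by measurable
  have rv [measurable]: "random_variable borel (X n)" if "n \<ge> 1" for n
    using indep that by (auto simp: indep_vars_def)
  have transfer: "integrable M (\<lambda>\<omega>. h (X n \<omega>)) = integrable M (\<lambda>\<omega>. h (X\<^sub>0 \<omega>))"
      "expectation (\<lambda>\<omega>. h (X n \<omega>)) = expectation (\<lambda>\<omega>. h (X\<^sub>0 \<omega>))"
    if "n \<ge> 1" "h \<in> borel_measurable borel"
    for n and h :: "'h \<Rightarrow> 'k::{banach, second_countable_topology}"
    using integrable_distr_eq[OF rv[OF that(1)] that(2)] integrable_distr_eq[OF X0 that(2)]
      integral_distr[OF rv[OF that(1)] that(2)] integral_distr[OF X0 that(2)] distr[OF that(1)]
    by simp_all
  have int1: "integrable M X\<^sub>0"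
    using integrable_norm_lower_power[OF finite_measure_axioms X0 int4, of 1]
    by (simp add: integrable_norm_iff)
  have int4': "integrable M (\<lambda>\<omega>. norm (X\<^sub>0 \<omega> - m) ^ 4)"
  proof (rule Bochner_Integration.integrable_bound)
    show "integrable M (\<lambda>\<omega>. 8 * (norm (X\<^sub>0 \<omega>) ^ 4 + norm m ^ 4))"
      using int4 by simp
    \<comment> \<open>The inequality \<open>sq\<close> is applied first to the norms and then to
      their squares, giving the constant \<open>2\<^sup>2 * 2 = 8\<close>.\<close>
    have "norm (x - m) ^ 4 \<le> 8 * (norm x ^ 4 + norm m ^ 4)" for x
    proof -
      have sq: "(a + b)\<^sup>2 \<le> 2 * (a\<^sup>2 + b\<^sup>2)" for a b :: real
        using sum_squares_bound[of a b] by (simp add: power2_sum)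
      have "norm (x - m) ^ 4 \<le> (norm x + norm m) ^ 4"
        by (intro power_mono norm_triangle_ineq4) simp
      also have "\<dots> = ((norm x + norm m)\<^sup>2)\<^sup>2"
        by simp
      also have "\<dots> \<le> (2 * ((norm x)\<^sup>2 + (norm m)\<^sup>2))\<^sup>2"
        by (intro power_mono sq) simp
      also have "\<dots> \<le> 8 * (norm x ^ 4 + norm m ^ 4)"
        unfolding power_mult_distrib using sq[of "(norm x)\<^sup>2" "(norm m)\<^sup>2"] by simp
      finally show ?thesis .
    qed
    then show "AE \<omega> in M. norm (norm (X\<^sub>0 \<omega> - m) ^ 4) \<le> norm (8 * (norm (X\<^sub>0 \<omega>) ^ 4 + norm m ^ 4))"
      by simp
  qed measurable
  have int2: "integrable M (\<lambda>\<omega>. (norm (X\<^sub>0 \<omega> - m))\<^sup>2)"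
    by (rule integrable_norm_lower_power[OF finite_measure_axioms _ int4']) simp_all
  have rank_int: "integrable M (\<lambda>\<omega>. rank_one (X\<^sub>0 \<omega> - m) (X\<^sub>0 \<omega> - m))"
    by (rule integrable_norm_cancel)
      (use int2 measurable_compose[OF X0 rank_meas] in \<open>simp_all add: norm_rank_one power2_eq_square\<close>)
  have C: "C = expectation (\<lambda>\<omega>. rank_one (X\<^sub>0 \<omega> - m) (X\<^sub>0 \<omega> - m))"
    by (simp add: C_def covariance_def m_def Let_def)
  have mean_g: "expectation (\<lambda>\<omega>. g (X\<^sub>0 \<omega>)) = 0"
    unfolding g_def using rank_int C by (simp add: prob_space)
  have mean: "expectation (\<lambda>\<omega>. X\<^sub>0 \<omega> - m) = 0"
    using int1 by (simp add: m_def prob_space)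
  \<comment> \<open>Here the fourth moment enters: the squared norm of
    \<open>rank_one (x - m) (x - m)\<close> is \<open>norm (x - m) ^ 4\<close>.\<close>
  have int_g: "integrable M (\<lambda>\<omega>. (norm (g (X\<^sub>0 \<omega>)))\<^sup>2)"
  proof (rule Bochner_Integration.integrable_bound)
    show "integrable M (\<lambda>\<omega>. 2 * (norm (X\<^sub>0 \<omega> - m) ^ 4 + (norm C)\<^sup>2))"
      using int4' by simp
    have "(norm (g x))\<^sup>2 \<le> 2 * (norm (x - m) ^ 4 + (norm C)\<^sup>2)" for x
    proof -
      have "norm (g x) \<le> (norm (x - m))\<^sup>2 + norm C"
        using norm_triangle_ineq4[of "rank_one (x - m) (x - m)" C]
        by (simp add: g_def norm_rank_one power2_eq_square)
      then have "(norm (g x))\<^sup>2 \<le> ((norm (x - m))\<^sup>2 + norm C)\<^sup>2"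
        by (intro power_mono) auto
      also have "\<dots> \<le> 2 * (norm (x - m) ^ 4 + (norm C)\<^sup>2)"
        using sum_squares_bound[of "(norm (x - m))\<^sup>2" "norm C"] by (simp add: power2_sum)
      finally show ?thesis .
    qed
    then show "AE \<omega> in M. norm ((norm (g (X\<^sub>0 \<omega>)))\<^sup>2) \<le> norm (2 * (norm (X\<^sub>0 \<omega> - m) ^ 4 + (norm C)\<^sup>2))"
      by simp
  qed measurable
  define Y where "Y N \<omega> = real N * (norm ((1 / real N) *\<^sub>R (\<Sum>n=1..N. g (X n \<omega>))))\<^sup>2" for N \<omega>
  define D where "D N \<omega> = real N * (norm ((1 / real N) *\<^sub>R (\<Sum>n=1..N. X n \<omega> - m)))\<^sup>2" for N \<omega>
  have Y: "integrable M (Y N)" "expectation (Y N) = expectation (\<lambda>\<omega>. (norm (g (X\<^sub>0 \<omega>)))\<^sup>2)" if "N \<ge> 1" for N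
    unfolding Y_def
    by (rule second_moment_average[OF indep_vars_compose2[OF indep] _ _ _ that];
        simp add: transfer transfer[of _ "\<lambda>x. (norm (g x))\<^sup>2"] int_g mean_g)+
  have D: "integrable M (D N)" "expectation (D N) = expectation (\<lambda>\<omega>. (norm (X\<^sub>0 \<omega> - m))\<^sup>2)" if "N \<ge> 1" for N
    unfolding D_def
    by (rule second_moment_average[OF indep_vars_compose2[OF indep, of "\<lambda>_ x. x - m"] _ _ _ that];
        simp add: transfer[of _ "\<lambda>x. x - m"] transfer[of _ "\<lambda>x. (norm (x - m))\<^sup>2"] int2 mean)+
  show thesis
  proof (rule that[of "\<lambda>N \<omega>. Y N \<omega> + D N \<omega>"])
    fix N :: nat and \<omega>
    assume N: "N \<ge> 1"
    define y where "y = (1 / real N) *\<^sub>R (\<Sum>n=1..N. g (X n \<omega>))"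
    define d where "d = empirical_mean X N \<omega> - m"
    have d: "(1 / real N) *\<^sub>R (\<Sum>n=1..N. X n \<omega> - m) = d"
      using N by (simp add: d_def empirical_mean_def sum_subtractf scaleR_diff_right sum_constant_scaleR)
    have "empirical_covariance X N \<omega> - C = y - rank_one d d"
      using N by (simp add: empirical_covariance_centered[OF N, of X \<omega> m] y_def d_def g_def
          sum_subtractf scaleR_diff_right sum_constant_scaleR)
    then have "norm (empirical_covariance X N \<omega> - C) \<le> norm y + (norm d)\<^sup>2"
      using norm_triangle_ineq4[of y "rank_one d d"] by (simp add: norm_rank_one power2_eq_square)
    then have "sqrt (real N) * norm (empirical_covariance X N \<omega> - C)
        \<le> sqrt (real N) * norm y + sqrt (real N) * (norm d)\<^sup>2"
      using mult_left_mono[of _ _ "sqrt (real N)"] by (fastforce simp: distrib_left)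
    \<comment> \<open>With \<open>t = sqrt (real N) * norm y\<close> this is
      \<open>t \<le> 1 + t\<^sup>2\<close>; it bounds the first-order error by a second moment and
      is the source of the 1 in the conclusion.\<close>
    also have "sqrt (real N) * norm y \<le> 1 + real N * (norm y)\<^sup>2"
    proof -
      have "2 * (sqrt (real N) * norm y) \<le> real N * (norm y)\<^sup>2 + 1"
        using sum_squares_bound[of "sqrt (real N) * norm y" 1] by (simp add: power_mult_distrib)
      moreover have "0 \<le> sqrt (real N) * norm y"
        by simp
      ultimately show ?thesis
        by linarith
    qed
    \<comment> \<open>The centered mean enters quadratically, so its contribution is of order
      \<open>1 / N\<close> and there is room to replace \<open>sqrt (real N)\<close> by
      \<open>real N\<close>.\<close>
    also have "sqrt (real N) * (norm d)\<^sup>2 \<le> real N * (norm d)\<^sup>2"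
      using N by (intro mult_right_mono real_le_lsqrt) (auto intro: self_le_power)
    finally show "sqrt (real N) * norm (empirical_covariance X N \<omega> - covariance M X\<^sub>0)
        \<le> 1 + (Y N \<omega> + D N \<omega>)"
      unfolding Y_def D_def d C_def y_def[symmetric] by linarith
  next
    fix N :: nat assume "N \<ge> 1"
    then show "integrable M (\<lambda>\<omega>. Y N \<omega> + D N \<omega>)"
      "expectation (\<lambda>\<omega>. Y N \<omega> + D N \<omega>) =
        expectation (\<lambda>\<omega>. (norm (g (X\<^sub>0 \<omega>)))\<^sup>2) + expectation (\<lambda>\<omega>. (norm (X\<^sub>0 \<omega> - m))\<^sup>2)"
      using Y[of N] D[of N] by simp_all
  next
    show "0 \<le> Y N \<omega> + D N \<omega>" for N \<omega>
      by (simp add: Y_def D_def)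
  qed
qed

lemma measurable_empirical_covariance:
  fixes X :: "nat \<Rightarrow> 'w \<Rightarrow> 'h::{real_inner, banach, second_countable_topology}"
  assumes X: "\<And>n. n \<ge> 1 \<Longrightarrow> X n \<in> borel_measurable M"
  shows "empirical_covariance X N \<in> borel_measurable M"
proof -
  have rank: "(\<lambda>x. rank_one x x :: ('h, 'h) hs) \<in> borel_measurable borel"
    by (intro borel_measurable_continuous_onI bounded_bilinear.continuous_on[OF bounded_bilinear_rank_one]
        continuous_intros)
  have mean: "empirical_mean X N \<in> borel_measurable M"
    unfolding empirical_mean_def using X by (intro borel_measurable_scaleR borel_measurable_sum) auto
  show ?thesis
    unfolding empirical_covariance_def
    using X mean by (intro borel_measurable_scaleR borel_measurable_sum measurable_compose[OF _ rank]
        borel_measurable_diff) auto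
qed

section \<open>Stochastic order from Markov's inequality, and the final bound\<close>

lemma (in prob_space) bigo_probI_Markov:
  assumes meas: "\<And>N. Z N \<in> borel_measurable M"
    and Q: "\<And>N. N \<ge> 1 \<Longrightarrow> integrable M (Q N)" "\<And>N. N \<ge> 1 \<Longrightarrow> expectation (Q N) = v"
      "\<And>N \<omega>. 0 \<le> Q N \<omega>"
    and le: "\<And>N \<omega>. N \<ge> 1 \<Longrightarrow> sqrt (real N) * \<bar>Z N \<omega>\<bar> \<le> Q N \<omega>"
    and "a > 0"
  shows "bigo_prob M Z (\<lambda>N. a / sqrt (real N))"
  unfolding bigo_prob_def
proof (intro conjI allI impI meas)
  fix \<epsilon> :: real assume "\<epsilon> > 0"
  have "v \<ge> 0"
    using Q(2)[of 1] Q(3) Bochner_Integration.integral_nonneg[of M "Q 1"] by simp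
  \<comment> \<open>A threshold at which Markov's bound \<open>v / c\<close> falls below \<epsilon>;
    adding 1 keeps \<open>c\<close> positive when \<open>v = 0\<close>.\<close>
  define c where "c = (v + 1) / \<epsilon>"
  have "c > 0" "v / c < \<epsilon>"
    using \<open>v \<ge> 0\<close> \<open>\<epsilon> > 0\<close> by (simp_all add: c_def field_simps)
  show "\<exists>K. \<forall>\<^sub>F N in sequentially. prob {\<omega> \<in> space M. \<bar>Z N \<omega>\<bar> > K * \<bar>a / sqrt (real N)\<bar>} < \<epsilon>"
  \<comment> \<open>Dividing by \<open>a\<close> cancels the constant of the rate: exceeding the
    bound means that \<open>sqrt (real N) * \<bar>Z N \<omega>\<bar>\<close> exceeds
    \<open>c\<close>.\<close>
  proof (intro exI[of _ "c / a"] eventually_sequentiallyI[of 1])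
    fix N :: nat assume N: "1 \<le> N"
    have "{\<omega> \<in> space M. \<bar>Z N \<omega>\<bar> > c / a * \<bar>a / sqrt (real N)\<bar>} \<subseteq> {\<omega> \<in> space M. Q N \<omega> \<ge> c}"
    proof safe
      fix \<omega> assume "\<bar>Z N \<omega>\<bar> > c / a * \<bar>a / sqrt (real N)\<bar>"
      then have "sqrt (real N) * \<bar>Z N \<omega>\<bar> > c"
        using \<open>a > 0\<close> N by (simp add: field_simps)
      then show "Q N \<omega> \<ge> c"
        using le[OF N, of \<omega>] by linarith
    qed
    then have "prob {\<omega> \<in> space M. \<bar>Z N \<omega>\<bar> > c / a * \<bar>a / sqrt (real N)\<bar>}
        \<le> prob {\<omega> \<in> space M. Q N \<omega> \<ge> c}"
      using borel_measurable_integrable[OF Q(1)[OF N]] by (intro finite_measure_mono) measurable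
    also have "\<dots> \<le> v / c"
      using integral_Markov_inequality_measure[OF Q(1)[OF N] sets.top] Q \<open>c > 0\<close> N by simp
    also have "\<dots> < \<epsilon>"
      by fact
    finally show "prob {\<omega> \<in> space M. \<bar>Z N \<omega>\<bar> > c / a * \<bar>a / sqrt (real N)\<bar>} < \<epsilon>" .
  qed
qed

text \<open>Strict decrease passes to the squares by nonnegativity, and every gap in the minimum
  starts at an index in \<open>{1..R}\<close>. This makes \<open>a_R\<close> a sum of well-defined
  positive quotients times \<open>norm C\<close>.\<close>

lemma score_gap_pos:
  assumes "\<And>j. 1 \<le> j \<Longrightarrow> 0 \<le> \<sigma> j" "\<forall>j\<in>{1..R}. \<sigma> j > \<sigma> (j + 1)" "i \<in> {1..R}"
  shows "0 < score_gap \<sigma> i"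
proof -
  have sq: "(\<sigma> j)\<^sup>2 > (\<sigma> (j + 1))\<^sup>2" if "j \<in> {1..R}" for j
    using assms that by (intro power_strict_mono) auto
  show ?thesis
  proof (cases "i = 1")
    case True
    then show ?thesis
      using sq[of 1] assms(3) by (simp add: score_gap_def numeral_2_eq_2)
  next
    case False
    then have "i - 1 \<in> {1..R}"
      using assms(3) by auto
    then show ?thesis
      using sq[of "i - 1"] sq[of i] False assms(3) by (simp add: score_gap_def)
  qed
qed

theorem theorem1:
  fixes tens :: "'a::{real_inner, banach, second_countable_topology} \<Rightarrow>
      'b::{real_inner, banach, second_countable_topology} \<Rightarrow>
      'h::{real_inner, banach, second_countable_topology}"
    and M :: "'w measure"
    and X\<^sub>0 :: "'w \<Rightarrow> 'h"
    and X :: "nat \<Rightarrow> 'w \<Rightarrow> 'h"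
    and C :: "('h, 'h) hs"
    and R :: nat
    and \<sigma> :: "nat \<Rightarrow> real"
    and A :: "nat \<Rightarrow> ('a, 'a) hs"
    and B :: "nat \<Rightarrow> ('b, 'b) hs"
    and a_R :: real
    and C_hat :: "nat \<Rightarrow> 'w \<Rightarrow> ('h, 'h) hs"
  assumes "hilbert_tensor tens"
    and "prob_space M"
    and "X\<^sub>0 \<in> borel_measurable M"
    and "prob_space.indep_vars M (\<lambda>_. borel) X {1..}"
    and "\<And>n. n \<ge> 1 \<Longrightarrow> distr M borel (X n) = distr M borel X\<^sub>0"
    and "integrable M (\<lambda>\<omega>. norm (X\<^sub>0 \<omega>) ^ 4)"
    and "C = covariance M X\<^sub>0"
    and "separable_expansion tens C \<sigma> A B"
    and "\<forall>i\<in>{1..R}. \<sigma> i > \<sigma> (i + 1)"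
    and "a_R = norm C * (\<Sum>i=1..R. \<sigma> i / score_gap \<sigma> i)"
    and "\<And>N \<omega>. N \<ge> 1 \<Longrightarrow> \<omega> \<in> space M \<Longrightarrow>
           best_separable_approx tens R (empirical_covariance X N \<omega>) (C_hat N \<omega>)"
  shows "\<exists>Z. (\<forall>N\<ge>1. \<forall>\<omega>\<in>space M.
               norm (C_hat N \<omega> - C) \<le> sqrt (\<Sum>i. (\<sigma> (R + 1 + i))\<^sup>2) + Z N \<omega>) \<and>
             bigo_prob M Z (\<lambda>N. a_R / sqrt (real N))"
proof -
  interpret hilbert_tensor tens by fact
  interpret prob_space M by fact
  note expansion = \<open>separable_expansion tens C \<sigma> A B\<close>
  note best = \<open>\<And>N \<omega>. N \<ge> 1 \<Longrightarrow> \<omega> \<in> space M \<Longrightarrow>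
    best_separable_approx tens R (empirical_covariance X N \<omega>) (C_hat N \<omega>)\<close>
  show ?thesis
  proof (cases "R = 0")
    case True
    then have "norm (C_hat N \<omega> - C) = sqrt (\<Sum>i. (\<sigma> (R + 1 + i))\<^sup>2)"
      if "N \<ge> 1" "\<omega> \<in> space M" for N \<omega>
      using best_separable_approx_0_error[OF expansion] best[OF that] by simp
    then show ?thesis
      using True by (intro exI[of _ "\<lambda>N \<omega>. 0"]) (simp add: bigo_prob_def assms(10))
  next
    case False
    have \<sigma>: "0 \<le> \<sigma> j" if "1 \<le> j" for j
      using expansion that by (simp add: separable_expansion_def)
    have \<sigma>_pos: "0 < \<sigma> i" if "i \<in> {1..R}" for i
      using assms(9) that \<sigma>[of "i + 1"] by force
    \<comment> \<open>Needed because \<open>norm C\<close> is a factor of \<open>a_R\<close>: the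
      squared norm of \<open>C\<close> is the sum of all squared scores, and the first is
      positive.\<close>
    have "C \<noteq> 0"
    proof
      assume "C = 0"
      then have "(\<lambda>i. (\<sigma> (1 + i))\<^sup>2) sums 0"
        using separable_expansion_tail[OF expansion, of 0] by simp
      then have "(\<sigma> 1)\<^sup>2 = 0"
        using suminf_eq_zero_iff[of "\<lambda>i. (\<sigma> (1 + i))\<^sup>2"] by (auto simp: sums_iff)
      then show False
        using \<sigma>_pos[of 1] False by simp
    qed
    have "(\<Sum>i=1..R. \<sigma> i / score_gap \<sigma> i) > 0"
      using False \<sigma>_pos score_gap_pos[OF \<sigma> assms(9)] by (intro sum_pos) auto
    then have "a_R > 0"
      using \<open>C \<noteq> 0\<close> by (simp add: assms(10))
    obtain Q v where Q: "\<And>N. N \<ge> 1 \<Longrightarrow> integrable M (Q N)"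
      "\<And>N. N \<ge> 1 \<Longrightarrow> expectation (Q N) = v" "\<And>N \<omega>. 0 \<le> Q N \<omega>"
      "\<And>N \<omega>. N \<ge> 1 \<Longrightarrow>
        sqrt (real N) * norm (empirical_covariance X N \<omega> - covariance M X\<^sub>0) \<le> 1 + Q N \<omega>"
      using empirical_covariance_error[OF assms(3-6)] by blast
    \<comment> \<open>Defined through the empirical covariance and not through \<open>C_hat\<close>,
      whose dependence on \<omega> is a choice among minimizers; this gives the measurability that
      \<open>bigo_prob\<close> demands.\<close>
    define Z where "Z N \<omega> = 2 * norm (empirical_covariance X N \<omega> - C)" for N \<omega>
    have "bigo_prob M Z (\<lambda>N. a_R / sqrt (real N))"
    proof (rule bigo_probI_Markov[where Q = "\<lambda>N \<omega>. 2 * (1 + Q N \<omega>)" and v = "2 * (1 + v)"])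
      have [measurable]: "empirical_covariance X N \<in> borel_measurable M" for N
        using assms(4) by (intro measurable_empirical_covariance) (auto simp: indep_vars_def)
      show "Z N \<in> borel_measurable M" for N
        unfolding Z_def by measurable
      show "sqrt (real N) * \<bar>Z N \<omega>\<bar> \<le> 2 * (1 + Q N \<omega>)" if "N \<ge> 1" for N \<omega>
        using Q(4)[OF that, of \<omega>] by (simp add: Z_def assms(7))
    qed (use Q \<open>a_R > 0\<close> in \<open>simp_all add: prob_space add_nonneg_nonneg\<close>)
    then show ?thesis
      using best_separable_approx_error[OF expansion best]
      by (intro exI[of _ Z]) (simp add: Z_def)
  qed
qed

end
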